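(* For a fixed positive integer $k$, as $n\to\infty$, $$\operatorname{Hdepth}_1M(n,k)=\frac12n+\frac12\sqrt{(k-1)n\log n}+\frac14\sqrt{\frac{(k-1)n}{\log n}}\,\log\log n+o\!\left(\sqrt{\frac{n}{\log n}}\,\log\log n\right).$$
   Context: $K$ is a field, $R=K[X_1,\dots,X_n]$ with the standard grading ($\deg X_i=1$). $M(n,k)$ is the $k$-th syzygy module of $K=R/(X_1,\dots,X_n)$ in the Koszul complex: the image of $\partial:\bigwedge^kR^n\to\bigwedge^{k-1}R^n$, $\partial(e_{i_1}\wedge\dots\wedge e_{i_k})=\sum_{r=1}^k(-1)^{r+1}X_{i_r}e_{i_1}\wedge\dots\widehat{e_{i_r}}\dots\wedge e_{i_k}$, where $e_{i_1}\wedge\dots\wedge e_{i_k}$ has degree $k$. A graded retract of $R$ is a $K$-subalgebra generated by a set of linear forms. A Hilbert decomposition of $M$ is a finite family $(S_i,s_i)$, $s_i\in\mathbb{Z}$, $S_i$ graded retracts, with $M\cong\bigoplus_iS_i(-s_i)$ as graded $K$-vector spaces; its depth is $\min_i\dim S_i$; $\operatorname{Hdepth}_1M$ is the maximal depth of such a decomposition. $\log$ is the natural logarithm. *)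

theory Defs
  imports "HOL-Analysis.Analysis" "HOL-Library.Poly_Mapping" "HOL-Library.Landau_Symbols" "HOL-Library.Function_Algebras"
begin

text \<open>Polynomials over a field 'a in the variables X_0, X_1, ... :
  finitely supported maps from monomials (exponent vectors) to coefficients.
  R = K[X_1..X_n] is modelled by the polynomials involving only X_0..X_(n-1).\<close>

type_synonym 'a mpoly = "(nat \<Rightarrow>\<^sub>0 nat) \<Rightarrow>\<^sub>0 'a"

definition Var :: "nat \<Rightarrow> 'a::comm_ring_1 mpoly" where
  "Var i = Poly_Mapping.single (Poly_Mapping.single i 1) 1"

definition Const :: "'a::comm_ring_1 \<Rightarrow> 'a mpoly" where
  "Const c = Poly_Mapping.single 0 c"

definition pscale :: "'a::comm_ring_1 \<Rightarrow> 'a mpoly \<Rightarrow> 'a mpoly" where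
  "pscale c p = Const c * p"

definition mdeg :: "(nat \<Rightarrow>\<^sub>0 nat) \<Rightarrow> nat" where
  "mdeg m = (\<Sum>i\<in>Poly_Mapping.keys m. Poly_Mapping.lookup m i)"

definition polyring :: "nat \<Rightarrow> 'a::comm_ring_1 mpoly set" where
  "polyring n = {p. \<forall>m\<in>Poly_Mapping.keys p. Poly_Mapping.keys m \<subseteq> {..<n}}"

text \<open>homogeneous of (integer) degree d; 0 is homogeneous of every degree\<close>
definition homog :: "int \<Rightarrow> 'a::comm_ring_1 mpoly \<Rightarrow> bool" where
  "homog d p \<longleftrightarrow> (\<forall>m\<in>Poly_Mapping.keys p. int (mdeg m) = d)"

definition linear_forms :: "nat \<Rightarrow> 'a::comm_ring_1 mpoly set" where
  "linear_forms n = {p \<in> polyring n. homog 1 p}"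

inductive_set alg_gen :: "'a::comm_ring_1 mpoly set \<Rightarrow> 'a mpoly set" for L where
  gen: "p \<in> L \<Longrightarrow> p \<in> alg_gen L"
| const: "Const c \<in> alg_gen L"
| add: "p \<in> alg_gen L \<Longrightarrow> q \<in> alg_gen L \<Longrightarrow> p + q \<in> alg_gen L"
| mult: "p \<in> alg_gen L \<Longrightarrow> q \<in> alg_gen L \<Longrightarrow> p * q \<in> alg_gen L"

definition component :: "'a::comm_ring_1 mpoly set \<Rightarrow> int \<Rightarrow> 'a mpoly set" where
  "component S j = {p \<in> S. homog j p}"

definition pdim :: "'a::field mpoly set \<Rightarrow> nat" where
  "pdim V = vector_space.dim pscale V"

text \<open>Elements of the free module \<And>^r R^n: coefficient functions on subsets I of {0..<n}
  (I standing for the basis element e_I), supported on r-subsets, coefficients in R.\<close>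
definition ext_module :: "nat \<Rightarrow> nat \<Rightarrow> (nat set \<Rightarrow> 'a::comm_ring_1 mpoly) set" where
  "ext_module n r = {f. \<forall>I. (f I \<noteq> 0 \<longrightarrow> I \<subseteq> {..<n} \<and> card I = r) \<and> f I \<in> polyring n}"

text \<open>Koszul differential: d(e_{i_1..i_k}) = sum_r (-1)^(r+1) X_{i_r} e_{..omit i_r..};
  the coefficient of e_I in d(f) is sum over i not in I of
  (-1)^(number of elements of I below i) X_i f(I \<union> {i}).\<close>
definition koszul_d :: "nat \<Rightarrow> (nat set \<Rightarrow> 'a::comm_ring_1 mpoly) \<Rightarrow> (nat set \<Rightarrow> 'a mpoly)" where
  "koszul_d n f = (\<lambda>I. \<Sum>i\<in>{..<n} - I.
      (-1) ^ card {j\<in>I. j < i} * Var i * f (insert i I))"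

definition Msyz :: "nat \<Rightarrow> nat \<Rightarrow> (nat set \<Rightarrow> 'a::comm_ring_1 mpoly) set" where
  "Msyz n k = koszul_d n ` ext_module n k"

text \<open>graded component of degree j of M(n,k); e_I has degree |I| = k-1\<close>
definition Msyz_comp :: "nat \<Rightarrow> nat \<Rightarrow> int \<Rightarrow> (nat set \<Rightarrow> 'a::comm_ring_1 mpoly) set" where
  "Msyz_comp n k j = {x \<in> Msyz n k. \<forall>I. homog (j - (int k - 1)) (x I)}"

definition Mdim :: "nat \<Rightarrow> nat \<Rightarrow> int \<Rightarrow> 'a::field itself \<Rightarrow> nat" where
  "Mdim n k j _ = vector_space.dim (\<lambda>c (x :: nat set \<Rightarrow> 'a mpoly) I. pscale c (x I))
                     (Msyz_comp n k j :: (nat set \<Rightarrow> 'a mpoly) set)"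

text \<open>A graded retract is alg_gen L for a set L of linear forms of R.
  Its (Krull) dimension equals the K-dimension of its degree-1 component
  (it is a polynomial ring in that many variables).\<close>
definition retract_dim :: "'a::field mpoly set \<Rightarrow> nat" where
  "retract_dim L = pdim (component (alg_gen L) 1)"

text \<open>Hilbert decomposition of M(n,k): a finite family (S_i, s_i), S_i = alg_gen L_i,
  with M \<cong> \<Oplus> S_i(-s_i) as graded K-vector spaces, i.e. equal dimension in every degree.\<close>
definition hilbert_decomp :: "nat \<Rightarrow> nat \<Rightarrow> ('a::field mpoly set \<times> int) list \<Rightarrow> bool" where
  "hilbert_decomp n k fam \<longleftrightarrow>
     (\<forall>(L, s) \<in> set fam. L \<subseteq> linear_forms n) \<and>
     (\<forall>j::int. Mdim n k j TYPE('a) =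
        (\<Sum>(L, s) \<leftarrow> fam. pdim (component (alg_gen L) (j - s))))"

definition decomp_depth :: "('a::field mpoly set \<times> int) list \<Rightarrow> nat" where
  "decomp_depth fam = Min ((\<lambda>(L, s). retract_dim L) ` set fam)"

definition Hdepth1 :: "'a::field itself \<Rightarrow> nat \<Rightarrow> nat \<Rightarrow> nat" where
  "Hdepth1 _ n k = Max {decomp_depth fam | fam :: ('a mpoly set \<times> int) list.
                          fam \<noteq> [] \<and> hilbert_decomp n k fam}"

end

theory Submission
  imports Defs "HOL-Real_Asymp.Real_Asymp"
begin

text \<open> In the Koszul complex the elements \<open>\<partial>(X\<^sup>m e\<^sub>I)\<close> with \<open>min I \<le> min (supp m)\<close> form a basis
  of \<open>M(n,k)\<close>: those with \<open>min (supp m) < min I\<close> are eliminated by \<open>\<partial>\<partial> = 0\<close>. Counting them gives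
  the Hilbert series \<open>T\<^sup>k \<Sum>\<^sub>l C(n-1-l, k-1) (1-T)\<^bsup>l-n\<^esup>\<close>. A retract of dimension \<open>d\<close> has Hilbert
  series \<open>(1-T)\<^bsup>-d\<^esup>\<close>, so \<open>M(n,k)\<close> has a Hilbert decomposition of depth at least \<open>r\<close> iff
  \<open>(1-T)\<^sup>r\<close> times its Hilbert series has nonnegative coefficients. With \<open>s = n - r\<close>, the
  coefficient of \<open>T\<^bsup>k+q\<^esup>\<close> in that product is \<open>P(q) + (-1)\<^sup>q C(r, k+q)\<close>, where \<open>P(q)\<close> lies
  between \<open>C(r,k-1) C(s+q,q+1)\<close> and \<open>C(n,k-1) C(s+q,q+1)\<close>. Hence, up to factors bounded in \<open>n\<close>,
  the condition is \<open>\<Prod>\<^sub>j\<^sub><\<^sub>p (r-j)/(s+j) \<le> p\<^bsup>k-1\<^esup>\<close> for even \<open>p\<close>. The left side is largest near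
  \<open>p = x := r - n/2\<close>, where it is about \<open>exp (2x\<^sup>2/n)\<close>, and solving \<open>2x\<^sup>2/n = (k-1) log x\<close> for
  \<open>x\<close> gives the expansion. \<close>

section \<open>Coefficients of the Hilbert series\<close>

text \<open>The shape of the expansion comes from \<open>2 x^2 / n = K log x\<close> with
  \<open>K = k - 1\<close>. For \<open>K > 0\<close> the solution \<open>x\<close> has order
  \<open>sqrt (n log n)\<close>, so \<open>log x = (log n + log log n) / 2 + O(1)\<close>, and this
  \<open>log log n\<close> produces the second term. A bounded factor in the inequality between
  binomials changes \<open>x^2\<close> by \<open>O(n)\<close>, hence \<open>x\<close> by
  \<open>O(sqrt (n / log n))\<close>, which the error term absorbs. This is why estimates as crude
  as \<open>(n/k)^k <= C(n,k) <= n^k\<close> suffice. Parity costs even less: a coefficient can be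
  negative only for odd \<open>q\<close>, that is for even \<open>p = q + 1\<close>, and moving to
  an even \<open>p\<close> near the maximum changes the logarithm of the product by
  \<open>O(1/n)\<close>. For \<open>K = 0\<close> both logarithmic terms vanish and the lower bound
  comes from \<open>r = n div 2\<close> directly.\<close>

text \<open>\<open>hcoeff d q\<close> is the coefficient of \<open>T\<^sup>q\<close> in \<open>(1-T)\<^bsup>-d\<^esup>\<close>, for \<open>d\<close> of either sign.\<close>

definition hcoeff :: "int \<Rightarrow> int \<Rightarrow> real" where
  "hcoeff d q = (if q < 0 then 0 else (-1) ^ nat q * (of_int (- d) gchoose nat q))"

lemma hcoeff_neg [simp]: "q < 0 \<Longrightarrow> hcoeff d q = 0"
  by (simp add: hcoeff_def)

text \<open>Multiplying \<open>(1-T)^(-d)\<close> by \<open>1 - T\<close> lowers \<open>d\<close> by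
  one; on coefficients this is Pascal's rule for generalized binomials, valid for \<open>d\<close>
  of either sign.\<close>

lemma hcoeff_diff: "hcoeff d q - hcoeff d (q - 1) = hcoeff (d - 1) q"
proof (cases "q \<le> 0")
  case True
  then show ?thesis by (cases "q = 0") (auto simp: hcoeff_def)
next
  case False
  define m where "m = nat (q - 1)"
  have m: "nat q = Suc m" "nat (q - 1) = m" using False by (auto simp: m_def)
  have "(of_int (1 - d) :: real) gchoose Suc m = (of_int (- d) gchoose m) + (of_int (- d) gchoose Suc m)"
    using gbinomial_Suc_Suc[of "of_int (- d) :: real" m] by (simp add: algebra_simps)
  then show ?thesis using False m by (simp add: hcoeff_def algebra_simps)
qed

lemma hcoeff_of_nat: "hcoeff (int d) (int q) = real ((d + q - 1) choose q)"
proof -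
  have "(- real d) gchoose q = (-1) ^ q * ((real d + real q - 1) gchoose q)"
    by (subst gbinomial_minus) simp
  moreover have "(real d + real q - 1) gchoose q = real ((d + q - 1) choose q)"
  \<comment> \<open>For \<open>d = q = 0\<close> the natural number \<open>d + q - 1\<close> is
    truncated to 0 while the real one is -1; both binomials are 1 because the lower index is
    0.\<close>
  proof (cases "d + q = 0")
    case False
    then have "real d + real q - 1 = real (d + q - 1)" by linarith
    then show ?thesis by (simp only: binomial_gbinomial)
  qed auto
  ultimately show ?thesis by (simp add: hcoeff_def flip: mult.assoc power_add)
qed

lemma hcoeff_uminus_of_nat: "hcoeff (- int i) (int q) = (-1) ^ q * real (i choose q)"
  by (simp add: hcoeff_def binomial_gbinomial)

lemma hcoeff_nonneg: "d \<ge> 0 \<Longrightarrow> hcoeff d q \<ge> 0"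
  using hcoeff_of_nat[of "nat d" "nat q"] by (cases "q < 0") auto

text \<open>Classify the subsets of {0..N} with a+b+1 elements by the element i that has exactly b
  elements of the subset below it. The induction applies Pascal's rule to the first factor, which
  lowers \<open>a\<close>; hence \<open>a\<close> is arbitrary.\<close>

lemma sum_choose_mult_choose:
  "(\<Sum>i\<le>N. ((N - i) choose a) * (i choose b)) = Suc N choose Suc (a + b)"
proof (induction N arbitrary: a)
  case 0
  show ?case by (cases a; cases b) auto
next
  case (Suc N)
  show ?case
  proof (cases a)
    case 0
    then show ?thesis using sum_choose_upper[of b "Suc N"] by simp
  next
    case a: (Suc a')
    have "(\<Sum>i\<le>Suc N. ((Suc N - i) choose a) * (i choose b))
        = (\<Sum>i\<le>N. ((Suc N - i) choose a) * (i choose b))"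
      unfolding a by simp
    also have "\<dots> = (\<Sum>i\<le>N. ((N - i) choose a') * (i choose b) + ((N - i) choose a) * (i choose b))"
      by (rule sum.cong) (simp_all add: a Suc_diff_le distrib_right)
    also have "\<dots> = (Suc N choose Suc (a' + b)) + (Suc N choose Suc (a + b))"
      by (simp only: sum.distrib Suc.IH)
    also have "\<dots> = Suc (Suc N) choose Suc (a + b)"
      unfolding a by simp
    finally show ?thesis .
  qed
qed

text \<open>\<open>diff_coeff n k r q\<close> is the coefficient of \<open>T\<^bsup>k+q\<^esup>\<close> in \<open>(1-T)\<^sup>r\<close> times the Hilbert series
  of \<open>M(n,k)\<close>; \<open>pos_part\<close> collects the summands with \<open>l < n - r\<close>, where the exponent of \<open>1-T\<close> is
  negative.\<close>

definition diff_coeff :: "nat \<Rightarrow> nat \<Rightarrow> nat \<Rightarrow> int \<Rightarrow> real" where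
  "diff_coeff n k r q = (\<Sum>l<n. real ((n - 1 - l) choose (k - 1)) * hcoeff (int n - int r - int l) q)"

definition pos_part :: "nat \<Rightarrow> nat \<Rightarrow> nat \<Rightarrow> nat \<Rightarrow> nat" where
  "pos_part n k r q = (\<Sum>l<n-r. ((n - 1 - l) choose (k - 1)) * ((n - r - l + q - 1) choose q))"

text \<open>The summands with l >= n - r are polynomials \<open>(1-T)^i\<close>, i = l - (n - r),
  with coefficients of sign \<open>(-1)^q\<close>. As n - 1 - l = r - 1 - i, their sum is a
  convolution of binomials and collapses to a single one.\<close>

lemma diff_coeff_eq:
  assumes "r \<le> n" "k > 0"
  shows "diff_coeff n k r (int q) = real (pos_part n k r q) + (-1) ^ q * real (r choose (k + q))"
proof -
  let ?f = "\<lambda>l. real ((n - 1 - l) choose (k - 1)) * hcoeff (int n - int r - int l) (int q)"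
  have "(\<Sum>l<n. ?f l) = (\<Sum>l<n-r. ?f l) + (\<Sum>l\<in>{n-r..<n}. ?f l)"
    using sum.atLeastLessThan_concat[of 0 "n - r" n ?f] by (simp add: lessThan_atLeast0)
  also have "(\<Sum>l<n-r. ?f l) = real (pos_part n k r q)"
    unfolding pos_part_def of_nat_sum
  proof (rule sum.cong)
    fix l assume "l \<in> {..<n - r}"
    then have "int n - int r - int l = int (n - r - l)" using assms by auto
    then show "?f l = real (((n - 1 - l) choose (k - 1)) * ((n - r - l + q - 1) choose q))"
      by (simp only: hcoeff_of_nat of_nat_mult)
  qed simp
  also have "(\<Sum>l\<in>{n-r..<n}. ?f l) = (\<Sum>i<r. (-1) ^ q * real (((r - 1 - i) choose (k - 1)) * (i
      choose q)))"
  proof (rule sum.reindex_bij_witness[of _ "\<lambda>i. n - r + i" "\<lambda>l. l - (n - r)"])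
    fix l assume l: "l \<in> {n-r..<n}"
    then have *: "int n - int r - int l = - int (l - (n - r))" using assms by auto
    have "n - 1 - l = r - 1 - (l - (n - r))" using l assms by auto
    then show "(-1) ^ q * real (((r - 1 - (l - (n - r))) choose (k - 1)) * ((l - (n - r)) choose q))
        = ?f l"
      unfolding * hcoeff_uminus_of_nat by simp
  qed (use assms in auto)
  also have "\<dots> = (-1) ^ q * real (\<Sum>i<r. (((r - 1 - i) choose (k - 1)) * (i choose q)))"
    by (simp add: sum_distrib_left)
  also have "(\<Sum>i<r. (((r - 1 - i) choose (k - 1)) * (i choose q))) = r choose (k + q)"
  proof (cases r)
    case (Suc N)
    then show ?thesis using sum_choose_mult_choose[of N "k - 1" q] assms
      by (simp add: lessThan_Suc_atMost)
  qed (use assms in auto)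
  finally show ?thesis unfolding diff_coeff_def by simp
qed

lemma hockey_stick: "(\<Sum>l<s. (s - l + q - 1) choose q) = (s + q) choose Suc q"
proof (induction s)
  case (Suc s)
  have "(\<Sum>l<Suc s. (Suc s - l + q - 1) choose q) = ((s + q) choose q) + (\<Sum>l<s. (s - l + q - 1) choose q)"
    by (subst sum.lessThan_Suc_shift) simp
  then show ?case using Suc by simp
qed simp

text \<open>For l < n - r the upper index n - 1 - l of the first factor lies between r and n, so
  this factor can be pulled out of the sum; what remains is \<open>hockey_stick\<close>. The next
  lemma is the other half.\<close>

lemma pos_part_le:
  assumes "r \<le> n"
  shows "pos_part n k r q \<le> (n choose (k - 1)) * ((n - r + q) choose Suc q)"
  unfolding pos_part_def hockey_stick[symmetric] sum_distrib_left
  by (intro sum_mono mult_right_mono binomial_right_mono) auto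

lemma pos_part_ge:
  assumes "r \<le> n"
  shows "pos_part n k r q \<ge> (r choose (k - 1)) * ((n - r + q) choose Suc q)"
  unfolding pos_part_def hockey_stick[symmetric] sum_distrib_left
  using assms by (intro sum_mono mult_right_mono binomial_right_mono) auto

text \<open>Choose K + p elements and mark K of them, or choose the p unmarked ones and then the K
  marked ones among the rest. This trades \<open>r choose (K + p)\<close> for
  \<open>r choose p\<close> at the price of factors polynomial in r and p.\<close>

lemma choose_split: "(r choose (K + p)) * ((K + p) choose K) = (r choose p) * ((r - p) choose K)"
proof (cases "K + p \<le> r")
  case True
  have "(K + p) choose K = (K + p) choose p"
    using binomial_symmetric[of K "K + p"] by simp
  then show ?thesis using choose_mult[of p "K + p" r] True by simp
next
  case False
  then show ?thesis by (cases "p \<le> r") (auto simp: binomial_eq_0)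
qed

lemma fact_mult_choose: "fact p * real (r choose p) = (\<Prod>j<p. real r - real j)"
  by (simp add: binomial_gbinomial gbinomial_prod_rev atLeast0LessThan)

text \<open>Together with \<open>fact_mult_choose\<close> this makes the quotient of
  \<open>r choose p\<close> by \<open>(s + p - 1) choose p\<close> the product of the (r-j)/(s+j),
  since \<open>fact p\<close> cancels.\<close>

lemma fact_mult_choose_rising:
  assumes "s > 0"
  shows "fact p * real ((s + p - 1) choose p) = (\<Prod>j<p. real s + real j)"
proof -
  have "(\<Prod>j<p. real s + real j) = (\<Prod>j<p. real (s + p - 1) - real j)"
    by (rule prod.reindex_bij_witness[of _ "\<lambda>j. p - 1 - j" "\<lambda>j. p - 1 - j"])
       (use assms in \<open>auto simp: of_nat_diff\<close>)
  then show ?thesis by (simp add: fact_mult_choose)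
qed

section \<open>Estimates for quotients of binomial coefficients\<close>

text \<open>Without the clipping the sum is p (a - p + 1), a parabola in p with maximum (a+1)^2/4.
  Clipping keeps only the positive terms, so the bound is uniform in p. The induction rests on a +
  (a-1)^2/4 = (a+1)^2/4.\<close>

lemma sum_max_diff_le:
  fixes a :: real
  shows "(\<Sum>j<p. max 0 (a - 2 * real j)) \<le> (a + 1)\<^sup>2 / 4"
proof (induction p arbitrary: a)
  case (Suc p)
  have "(\<Sum>j<Suc p. max 0 (a - 2 * real j)) = max 0 a + (\<Sum>j<p. max 0 ((a - 2) - 2 * real j))"
    by (subst sum.lessThan_Suc_shift) (simp add: algebra_simps)
  also have "\<dots> \<le> max 0 a + (a - 1)\<^sup>2 / 4"
    using Suc[of "a - 2"] by simp
  finally have *: "(\<Sum>j<Suc p. max 0 (a - 2 * real j)) \<le> max 0 a + (a - 1)\<^sup>2 / 4" .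
  show ?case
  proof (cases "a \<ge> 0")
    case True
    then show ?thesis using * by (simp add: power2_eq_square field_simps)
  next
    case False
    then have "(\<Sum>j<Suc p. max 0 (a - 2 * real j)) = 0" by (intro sum.neutral) auto
    then show ?thesis by simp
  qed
qed simp

lemma ln_one_plus_scaled:
  fixes t z :: real
  assumes "0 \<le> t" "t \<le> 1" "z \<ge> 0"
  shows "t * ln (1 + z) \<le> ln (1 + t * z)"
  using concave_onD[OF ln_concave, of t 1 "1 + z"] assms by (simp add: algebra_simps)

text \<open>The logarithm of \<open>\<Prod>\<^sub>j\<^sub><\<^sub>p (r-j)/(s+j)\<close> is at most both \<open>a p / s\<close> and \<open>(a+1)\<^sup>2/(4s)\<close> with
  \<open>a = r - s\<close>; since \<open>ln (1 + p/K)\<close> is concave in \<open>p\<close>, the comparison for all \<open>p\<close> follows from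
  the one at \<open>p = a/4\<close>.\<close>

lemma choose_le_mult_rising:
  fixes r s K p :: nat
  assumes s: "s > 0" and K: "K > 0" and rs: "r > s"
    and bound: "(real r - real s + 1)\<^sup>2 / (4 * real s) \<le> real K * ln (1 + (real r - real s) / (4 *
        real K))"
  shows "r choose p \<le> ((K + p) choose K) * ((s + p - 1) choose p)"
proof (cases "p \<le> r")
  case True
  define a where "a = real r - real s"
  have a: "a > 0" using rs by (simp add: a_def)
  define E where "E = (\<Sum>j<p. max 0 (a - 2 * real j)) / real s"
  \<comment> \<open>Each factor uses r - j = (s + j) + (a - 2j) and 1 + x \<le> exp x. Clipping the
    numerator at 0 is what allows the denominator s + j to be lowered to s.\<close>
  have "(\<Prod>j<p. real r - real j) \<le> (\<Prod>j<p. (real s + real j) * exp (max 0 (a - 2 * real j) /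
      real s))"
  proof (rule prod_mono, safe)
    fix j assume j: "j < p"
    then show "0 \<le> real r - real j" using True by auto
    have "real r - real j = (real s + real j) * (1 + (a - 2 * real j) / (real s + real j))"
      using s by (simp add: a_def field_simps)
    also have "\<dots> \<le> (real s + real j) * exp ((a - 2 * real j) / (real s + real j))"
      by (intro mult_left_mono exp_ge_add_one_self) auto
    also have "\<dots> \<le> (real s + real j) * exp (max 0 (a - 2 * real j) / real s)"
    proof -
      have "(a - 2 * real j) / (real s + real j) \<le> max 0 (a - 2 * real j) / (real s + real j)"
        by (intro divide_right_mono) auto
      also have "\<dots> \<le> max 0 (a - 2 * real j) / real s"
        using s by (intro divide_left_mono) auto
      finally show ?thesis by (intro mult_left_mono) auto
    qed
    finally show "real r - real j \<le> (real s + real j) * exp (max 0 (a - 2 * real j) / real s)" .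
  qed
  also have "\<dots> = (\<Prod>j<p. real s + real j) * exp E"
    by (simp add: prod.distrib exp_sum E_def sum_divide_distrib)
  finally have "fact p * real (r choose p) \<le> fact p * (real ((s + p - 1) choose p) * exp E)"
    unfolding mult.assoc[symmetric] fact_mult_choose_rising[OF s] fact_mult_choose[of p r] .
  then have main: "real (r choose p) \<le> real ((s + p - 1) choose p) * exp E"
    by simp
  have E1: "E \<le> (a + 1)\<^sup>2 / (4 * real s)"
    using sum_max_diff_le[of a p] s unfolding E_def
    by (simp add: divide_simps)
  have E2: "E \<le> a * real p / real s"
  proof -
    have "(\<Sum>j<p. max 0 (a - 2 * real j)) \<le> (\<Sum>j<p. a)" using a by (intro sum_mono) auto
    then show ?thesis unfolding E_def using s by (intro divide_right_mono) (auto simp: mult.commute)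
  qed
  \<comment> \<open>At p = a/4 the linear bound a p / s takes the value a^2/(4s), just below the
    uniform bound (a+1)^2/(4s). Beyond this point the uniform bound is used, before it the linear
    one.\<close>
  have "E \<le> real K * ln (1 + real p / real K)"
  proof (cases "real p \<ge> a / 4")
    case True
    then have "a / (4 * real K) \<le> real p / real K" using K by (simp add: field_simps)
    then have "real K * ln (1 + a / (4 * real K)) \<le> real K * ln (1 + real p / real K)"
      using a K by (intro mult_left_mono ln_mono) (auto intro!: add_pos_nonneg)
    then show ?thesis using E1 bound a_def by simp
  next
    case False
    define t where "t = real p / (a / 4)"
    have t: "0 \<le> t" "t \<le> 1" using False a by (auto simp: t_def field_simps)
    have "E \<le> t * (a\<^sup>2 / (4 * real s))"
      using E2 a by (simp add: t_def power2_eq_square mult.commute)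
    also have "\<dots> \<le> t * ((a + 1)\<^sup>2 / (4 * real s))"
      using a t by (intro mult_left_mono divide_right_mono power_mono) auto
    also have "\<dots> \<le> t * (real K * ln (1 + a / (4 * real K)))"
      using bound t by (intro mult_left_mono) (auto simp: a_def)
    also have "\<dots> = real K * (t * ln (1 + a / (4 * real K)))" by simp
    also have "\<dots> \<le> real K * ln (1 + t * (a / (4 * real K)))"
      using ln_one_plus_scaled[OF t, of "a / (4 * real K)"] a by (intro mult_left_mono) auto
    also have "t * (a / (4 * real K)) = real p / real K"
      using a by (simp add: t_def)
    finally show ?thesis .
  qed
  \<comment> \<open>The right-hand side equals ((K+p)/K)^K, a lower bound for
    \<open>(K + p) choose K\<close>; this is the origin of K ln (1 + p/K).\<close>
  then have "exp E \<le> exp (real K * ln (1 + real p / real K))" by simp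
  also have "\<dots> = (1 + real p / real K) ^ K"
    using K by (simp add: exp_of_nat_mult add_pos_nonneg)
  also have "\<dots> = (real (K + p) / real K) ^ K"
    using K by (simp add: field_simps)
  also have "\<dots> \<le> real ((K + p) choose K)"
    by (rule binomial_ge_n_over_k_pow_k) simp
  finally have "real ((s + p - 1) choose p) * exp E \<le> real ((s + p - 1) choose p) * real ((K + p)
      choose K)"
    by (intro mult_left_mono) auto
  with main have "real (r choose p) \<le> real (((K + p) choose K) * ((s + p - 1) choose p))"
    by (simp add: mult.commute)
  then show ?thesis by (simp only: of_nat_le_iff)
next
  case False
  then show ?thesis by (simp add: binomial_eq_0)
qed

text \<open>This is artanh y \<ge> y in exponential form: the derivative 1/(1+x) + 1/(1-x) of the
  logarithm of (1+x)/(1-x) is at least 2.\<close>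

lemma exp_two_mult_le:
  fixes y :: real
  assumes "0 \<le> y" "y < 1"
  shows "(1 - y) * exp (2 * y) \<le> 1 + y"
proof -
  define f where "f = (\<lambda>y::real. ln (1 + y) - ln (1 - y) - 2 * y)"
  have "f 0 \<le> f y"
  proof (rule DERIV_nonneg_imp_nondecreasing[OF assms(1)])
    fix x assume x: "0 \<le> x" "x \<le> y"
    have "(f has_real_derivative (1 / (1 + x) + 1 / (1 - x) - 2)) (at x)"
      unfolding f_def using x assms by (auto intro!: derivative_eq_intros)
    moreover have "1 / (1 + x) + 1 / (1 - x) - 2 = 2 * x\<^sup>2 / (1 - x\<^sup>2)"
    proof -
      have "1 + x \<noteq> 0" "1 - x \<noteq> 0" using x assms by auto
      moreover have "1 - x\<^sup>2 = (1 + x) * (1 - x)" by (simp add: algebra_simps power2_eq_square)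
      ultimately show ?thesis by (simp add: divide_simps)
    qed
    moreover have "x\<^sup>2 \<le> 1" using x assms by (simp add: power_le_one)
    ultimately show "\<exists>d. (f has_real_derivative d) (at x) \<and> 0 \<le> d" by auto
  qed
  then have "ln (1 - y) + 2 * y \<le> ln (1 + y)" by (simp add: f_def)
  then have "exp (ln (1 - y) + 2 * y) \<le> exp (ln (1 + y))" by simp
  then show ?thesis using assms by (simp add: exp_add)
qed

text \<open>Here \<open>p\<close> is even and within distance 2 of \<open>a/2\<close>, where the product of the \<open>(r-j)/(s+j)\<close> is
  maximal.\<close>

lemma exp_le_of_choose_le:
  fixes n r K a p :: nat
  assumes rn: "r < n" and a: "2 * r = n + a" and p: "p = 2 * (a div 4)" and K: "2 * K \<le> n"
    and le: "r choose (K + p) \<le> (n choose K) * ((n - r + p - 1) choose p)"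
  shows "exp (((real a)\<^sup>2 / 2 - 8) / real n) \<le> real (2 * K * (K + p)) ^ K"
proof -
  have n: "n > 0" using rn by simp
  have pa: "2 * p \<le> a" "a < 2 * p + 4" unfolding p by auto
  define s where "s = n - r"
  have s: "s > 0" "real s = real n - real r" using rn by (auto simp: s_def)
  have r2: "2 * real r = real n + real a" using a by linarith
  define E where "E = (\<Sum>j<p. 2 * (real a - 2 * real j) / real n)"
  have "(\<Prod>j<p. real s + real j) * exp E
      = (\<Prod>j<p. (real s + real j) * exp (2 * (real a - 2 * real j) / real n))"
    by (simp add: prod.distrib exp_sum E_def)
  also have "\<dots> \<le> (\<Prod>j<p. real r - real j)"
  proof (rule prod_mono, safe)
    fix j assume j: "j < p"
    show "0 \<le> (real s + real j) * exp (2 * (real a - 2 * real j) / real n)" by simp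
    \<comment> \<open>Since r + s = n and r - s = a, the numbers r - j and s + j are symmetric about
      n/2, and y is their relative deviation from it.\<close>
    define y where "y = (real a - 2 * real j) / real n"
    have "a < n" using a rn by simp
    then have y: "0 \<le> y" "y < 1" using j pa n by (auto simp: y_def divide_simps)
    have "real n * y = real a - 2 * real j" using n by (simp add: y_def)
    then have "real s + real j = real n / 2 * (1 - y)" "real r - real j = real n / 2 * (1 + y)"
      using s r2 by (auto simp: algebra_simps)
    moreover have "2 * (real a - 2 * real j) / real n = 2 * y" by (simp add: y_def)
    moreover have "real n / 2 * (1 - y) * exp (2 * y) \<le> real n / 2 * (1 + y)"
      using mult_left_mono[OF exp_two_mult_le[OF y], of "real n / 2"] by (simp only: mult.assoc)
    ultimately show "(real s + real j) * exp (2 * (real a - 2 * real j) / real n) \<le> real r - real j"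
      by metis
  qed
  finally have "fact p * (real ((s + p - 1) choose p) * exp E) \<le> fact p * real (r choose p)"
    unfolding mult.assoc[symmetric] fact_mult_choose_rising[OF s(1)] fact_mult_choose[of p r] .
  then have main: "real ((s + p - 1) choose p) * exp E \<le> real (r choose p)"
    by simp
  have rp: "n \<le> 2 * (r - p)" "K \<le> r - p" using pa a K by auto
  \<comment> \<open>From r - p \<ge> n/2 one gets (n/(2K))^K as a lower bound for
    \<open>(r - p) choose K\<close>, against the upper bound n^K for \<open>n choose K\<close>. The
    powers of n cancel and (2K (K+p))^K is left.\<close>
  have "real (n ^ K) * real (r choose p) \<le> real (n ^ K) * (real (2 * K * (K + p)) ^ K * real ((s + p - 1)
      choose p))"
  proof (cases "K = 0")
    case True
    then show ?thesis using le by (simp add: s_def)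
  next
    case False
    have "(real n / (2 * real K)) ^ K \<le> (real (r - p) / real K) ^ K"
      using rp False by (intro power_mono) (auto simp: field_simps)
    also have "\<dots> \<le> real ((r - p) choose K)"
      using rp by (intro binomial_ge_n_over_k_pow_k)
    finally have "(real n / (2 * real K)) ^ K * real (r choose p) \<le> real ((r - p) choose K) * real (r
        choose p)"
      by (rule mult_right_mono) simp
    also have "\<dots> = real ((r choose (K + p)) * ((K + p) choose K))"
      unfolding choose_split by simp
    also have "\<dots> \<le> real (((n choose K) * ((s + p - 1) choose p)) * (K + p) ^ K)"
      using le by (intro of_nat_mono mult_mono binomial_le_pow) (auto simp: s_def)
    also have "\<dots> \<le> real ((n ^ K * ((s + p - 1) choose p)) * (K + p) ^ K)"
      using K by (intro of_nat_mono mult_mono binomial_le_pow) auto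
    finally have "real (2 * K) ^ K * ((real n / (2 * real K)) ^ K * real (r choose p))
        \<le> real (2 * K) ^ K * real ((n ^ K * ((s + p - 1) choose p)) * (K + p) ^ K)"
      by (rule mult_left_mono) simp
    moreover define w where "w = real (K + p)"
    have "real (2 * K * (K + p)) = 2 * real K * w" by (simp add: w_def)
    ultimately show ?thesis using False
      by (simp add: power_mult_distrib power_divide mult_ac del: of_nat_add flip: w_def)
  qed
  then have "real (r choose p) \<le> real (2 * K * (K + p)) ^ K * real ((s + p - 1) choose p)"
    using n by (simp del: of_nat_mult)
  with main have "real ((s + p - 1) choose p) * exp E \<le> real ((s + p - 1) choose p) * real (2 * K * (K +
      p)) ^ K"
    by (simp add: mult.commute)
  moreover have "(s + p - 1) choose p > 0" using s by (simp add: zero_less_binomial_iff)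
  ultimately have "exp E \<le> real (2 * K * (K + p)) ^ K" by simp
  moreover have "((real a)\<^sup>2 / 2 - 8) / real n \<le> E"
  proof -
    have "(\<Sum>j<p. real a - 2 * real j) = real p * (real a - real p + 1)"
      by (induction p) (auto simp: algebra_simps)
    then have "E = 2 * (real p * (real a - real p + 1)) / real n"
      unfolding E_def sum_divide_distrib[symmetric] sum_distrib_left[symmetric] by simp
    \<comment> \<open>Here 2p(a-p) = (a^2 - (a-2p)^2)/2, and the distance a - 2p, at most 4 because
      of the division by 4, costs at most 8.\<close>
    moreover have "(real a)\<^sup>2 / 2 - 8 \<le> 2 * (real p * (real a - real p + 1))"
    proof -
      have "real a - 2 * real p \<ge> 0" "real a - 2 * real p \<le> 4" using pa by auto
      then have "(real a - 2 * real p)\<^sup>2 \<le> 4\<^sup>2" by (intro power_mono)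
      then show ?thesis by (simp add: algebra_simps power2_eq_square)
    qed
    ultimately show ?thesis by (simp add: divide_right_mono)
  qed
  ultimately show ?thesis by (meson exp_le_cancel_iff order_trans)
qed

section \<open>Polynomials and substitution homomorphisms\<close>

lemma lookup_pscale [simp]: "Poly_Mapping.lookup (pscale c p) m = c * Poly_Mapping.lookup p m"
  unfolding pscale_def Const_def mult_map_scale_conv_mult[symmetric]
  by (simp add: Poly_Mapping.map.rep_eq when_def)

lemma pscale_mult_pscale: "pscale c p * pscale d q = pscale (c * d) (p * q)"
proof -
  have "Const (c * d) = Const c * (Const d :: 'a mpoly)"
    by (simp add: Const_def mult_single)
  then show ?thesis by (simp add: pscale_def mult_ac)
qed

interpretation mpoly: vector_space "pscale :: 'a::field \<Rightarrow> 'a mpoly \<Rightarrow> 'a mpoly"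
  by unfold_locales (auto intro!: poly_mapping_eqI simp: lookup_add algebra_simps)

interpretation mpoly_pair: vector_space_pair
  "pscale :: 'a::field \<Rightarrow> 'a mpoly \<Rightarrow> 'a mpoly" "pscale :: 'a::field \<Rightarrow> 'a
      mpoly \<Rightarrow> 'a mpoly"
  by unfold_locales

text \<open>The kernel of a linear functional that vanishes on B - {b} contains the span of B - {b},
  so it would contain b. The criterion serves both the monomials and the generators of the syzygy
  module.\<close>

lemma (in vector_space) independent_if_coordinates:
  assumes "\<And>b. b \<in> B \<Longrightarrow> \<exists>\<phi>. (\<forall>x y. \<phi> (x + y) = \<phi> x +
      \<phi> y) \<and> (\<forall>c x. \<phi> (scale c x) = c * \<phi> x) \<and>
      \<phi> b \<noteq> 0 \<and> (\<forall>b'\<in>B - {b}. \<phi> b' = (0::'a))"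
  shows "independent B"
proof
  assume "dependent B"
  then obtain b where b: "b \<in> B" "b \<in> span (B - {b})" by (auto simp: dependent_def)
  from assms[OF b(1)] obtain \<phi> where \<phi>: "\<And>x y. \<phi> (x + y) = \<phi> x + \<phi> y" "\<And>c
      x. \<phi> (scale c x) = c * \<phi> x"
      "\<phi> b \<noteq> 0" "\<And>b'. b'\<in>B - {b} \<Longrightarrow> \<phi> b' = 0" by blast
  have "subspace {x. \<phi> x = 0}"
    using \<phi>(2)[of 0 0] by (auto simp: subspace_def \<phi>)
  then have "span (B - {b}) \<subseteq> {x. \<phi> x = 0}"
    by (intro span_minimal) (use \<phi> in auto)
  then show False using b \<phi> by auto
qed

lemma poly_mapping_eq_sum_single:
  assumes "finite A" "Poly_Mapping.keys p \<subseteq> A"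
  shows "p = (\<Sum>m\<in>A. Poly_Mapping.single m (Poly_Mapping.lookup p m))"
proof (rule poly_mapping_eqI)
  fix k
  show "Poly_Mapping.lookup p k = Poly_Mapping.lookup (\<Sum>m\<in>A. Poly_Mapping.single m
      (Poly_Mapping.lookup p m)) k"
    using assms by (auto simp: lookup_sum lookup_single when_def in_keys_iff)
qed

lemma pscale_single [simp]: "pscale c (Poly_Mapping.single m d) = Poly_Mapping.single m (c * d)"
  by (simp add: pscale_def Const_def mult_single)

lemma keys_pscale_subset: "Poly_Mapping.keys (pscale c p) \<subseteq> Poly_Mapping.keys p"
  by (auto simp: in_keys_iff)

lemma subspace_keys_subset: "mpoly.subspace {p :: 'a::field mpoly. Poly_Mapping.keys p \<subseteq> S}"
  unfolding mpoly.subspace_def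
  by (simp add: order_trans[OF keys_add Un_least] order_trans[OF keys_pscale_subset])

lemma span_monomials:
  "mpoly.span ((\<lambda>m. Poly_Mapping.single m (1::'a::field)) ` S) = {p. Poly_Mapping.keys p \<subseteq> S}"
proof
  show "mpoly.span ((\<lambda>m. Poly_Mapping.single m (1::'a::field)) ` S) \<subseteq> {p. Poly_Mapping.keys
      p \<subseteq> S}"
    by (rule mpoly.span_minimal[OF _ subspace_keys_subset]) auto
  show "{p. Poly_Mapping.keys p \<subseteq> S} \<subseteq> mpoly.span ((\<lambda>m. Poly_Mapping.single m
      (1::'a::field)) ` S)"
  proof
    fix p :: "'a mpoly" assume p: "p \<in> {p. Poly_Mapping.keys p \<subseteq> S}"
    have "(\<Sum>m\<in>Poly_Mapping.keys p. pscale (Poly_Mapping.lookup p m) (Poly_Mapping.single m 1))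
         \<in> mpoly.span ((\<lambda>m. Poly_Mapping.single m (1::'a::field)) ` S)"
      using p by (intro mpoly.span_sum mpoly.span_scale mpoly.span_base) auto
    then show "p \<in> mpoly.span ((\<lambda>m. Poly_Mapping.single m (1::'a::field)) ` S)"
      using poly_mapping_eq_sum_single[of "Poly_Mapping.keys p" p] by simp
  qed
qed

lemma independent_monomials:
  "mpoly.independent ((\<lambda>m. Poly_Mapping.single m (1::'a::field)) ` S)"
proof (rule mpoly.independent_if_coordinates)
  fix b :: "'a mpoly" assume "b \<in> (\<lambda>m. Poly_Mapping.single m 1) ` S"
  then obtain m where m: "b = Poly_Mapping.single m 1" by auto
  show "\<exists>\<phi>. (\<forall>x y. \<phi> (x + y) = \<phi> x + \<phi> y) \<and> (\<forall>c x. \<phi>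
      (pscale c x) = c * \<phi> x) \<and>
      \<phi> b \<noteq> 0 \<and> (\<forall>b'\<in>(\<lambda>m. Poly_Mapping.single m 1) ` S - {b}. \<phi> b'
          = (0::'a))"
    by (rule exI[of _ "\<lambda>p. Poly_Mapping.lookup p m"]) (auto simp: m lookup_add lookup_single when_def
        split: if_splits)
qed

lemma inj_on_monomials: "inj_on (\<lambda>m. Poly_Mapping.single m (1::'a::field)) S"
proof (rule inj_onI)
  fix m m' :: 'b assume "Poly_Mapping.single m (1::'a) = Poly_Mapping.single m' 1"
  then have "Poly_Mapping.keys (Poly_Mapping.single m (1::'a)) = Poly_Mapping.keys
      (Poly_Mapping.single m'
      (1::'a))"
    by simp
  then show "m = m'" by simp
qed

section \<open>Degrees and the number of monomials of given degree\<close>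

lemma mdeg_eq:
  assumes "finite A" "Poly_Mapping.keys m \<subseteq> A"
  shows "mdeg m = (\<Sum>i\<in>A. Poly_Mapping.lookup m i)"
  unfolding mdeg_def using assms by (intro sum.mono_neutral_left) (auto simp: in_keys_iff)

lemma mdeg_add: "mdeg (m + m') = mdeg m + mdeg m'"
proof -
  let ?A = "Poly_Mapping.keys m \<union> Poly_Mapping.keys m'"
  have "Poly_Mapping.keys (m + m') \<subseteq> ?A" by (rule keys_add)
  then show ?thesis by (simp add: mdeg_eq[of ?A] lookup_add sum.distrib)
qed

lemma mdeg_single [simp]: "mdeg (Poly_Mapping.single i c) = c"
  by (simp add: mdeg_def)

lemma mdeg_zero [simp]: "mdeg 0 = 0"
  by (simp add: mdeg_def)

text \<open>Stars and bars: reading off the exponents along an enumeration of A identifies the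
  monomials with the lists of length |A| and sum q.\<close>

lemma card_monomials:
  assumes "finite A"
  shows "card {m. Poly_Mapping.keys m \<subseteq> A \<and> mdeg m = q} = (card A + q - 1) choose q"
    and "finite {m. Poly_Mapping.keys m \<subseteq> A \<and> mdeg m = q}"
proof -
  obtain xs where xs: "set xs = A" "distinct xs" using assms finite_distinct_list by blast
  then have len: "length xs = card A" by (metis distinct_card)
  let ?M = "{m. Poly_Mapping.keys m \<subseteq> A \<and> mdeg m = q}"
  let ?L = "{l::nat list. size l = card A \<and> sum_list l = q}"
  let ?f = "\<lambda>m. map (Poly_Mapping.lookup m) xs"
  have inj: "inj_on ?f ?M"
  proof (rule inj_onI)
    fix m m' assume m: "m \<in> ?M" "m' \<in> ?M" "?f m = ?f m'"
    show "m = m'"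
    proof (rule poly_mapping_eqI)
      fix k
      show "Poly_Mapping.lookup m k = Poly_Mapping.lookup m' k"
      proof (cases "k \<in> A")
        case True
        then show ?thesis using m(3) xs by auto
      next
        case False
        then have "k \<notin> Poly_Mapping.keys m" "k \<notin> Poly_Mapping.keys m'" using m by auto
        then show ?thesis by (simp add: in_keys_iff)
      qed
    qed
  qed
  have "?f ` ?M = ?L"
  proof (intro equalityI subsetI)
    fix l assume "l \<in> ?f ` ?M"
    then obtain m where m: "Poly_Mapping.keys m \<subseteq> A" "mdeg m = q" "l = ?f m" by auto
    have "sum_list l = q"
      using m mdeg_eq[of A m] assms xs by (simp add: sum_list_distinct_conv_sum_set)
    then show "l \<in> ?L" using m len by simp
  next
    fix l assume l: "l \<in> ?L"
    define m where "m = Poly_Mapping.the_value (zip xs l)"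
    have lm: "Poly_Mapping.lookup m k = (case map_of (zip xs l) k of None \<Rightarrow> 0 | Some v
        \<Rightarrow> v)" for k
      by (simp add: m_def lookup_the_value)
    have k: "Poly_Mapping.keys m \<subseteq> A"
      using l len xs by (auto simp: in_keys_iff lm split: option.splits dest!: map_of_SomeD
          set_zip_leftD)
    have fm: "?f m = l"
    proof (rule nth_equalityI)
      fix i assume "i < length (?f m)"
      then show "?f m ! i = l ! i"
        using l len xs by (simp add: lm map_of_zip_nth)
    qed (use l len in auto)
    have "mdeg m = q"
      using l mdeg_eq[OF assms k] fm xs by (metis (mono_tags, lifting) mem_Collect_eq
          sum_list_distinct_conv_sum_set)
    then show "l \<in> ?f ` ?M" using k fm by (intro image_eqI[of _ _ m]) auto
  qed
  then have b: "bij_betw ?f ?M ?L" using inj by (simp add: bij_betw_def)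
  have "card ?L = (q + card A - 1) choose q" by (rule card_length_sum_list)
  then show "card ?M = (card A + q - 1) choose q"
    using bij_betw_same_card[OF b] by (simp add: add.commute)
  have "?L \<subseteq> {l. set l \<subseteq> {..q} \<and> length l = card A}"
    using member_le_sum_list by auto
  then have "finite ?L" using finite_lists_length_eq[of "{..q}" "card A"] finite_subset by auto
  then show "finite ?M" using bij_betw_finite[OF b] by simp
qed

section \<open>Algebra homomorphisms given by the images of the variables\<close>

definition monomial_subst :: "(nat \<Rightarrow> 'a::comm_ring_1 mpoly) \<Rightarrow> (nat
    \<Rightarrow>\<^sub>0 nat) \<Rightarrow> 'a mpoly" where
  "monomial_subst \<sigma> m = (\<Prod>i\<in>Poly_Mapping.keys m. \<sigma> i ^ Poly_Mapping.lookup m i)"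

definition subst :: "(nat \<Rightarrow> 'a::comm_ring_1 mpoly) \<Rightarrow> 'a mpoly \<Rightarrow> 'a mpoly" where
  "subst \<sigma> p = (\<Sum>m\<in>Poly_Mapping.keys p. pscale (Poly_Mapping.lookup p m) (monomial_subst
      \<sigma> m))"

lemma monomial_subst_eq:
  assumes "finite A" "Poly_Mapping.keys m \<subseteq> A"
  shows "monomial_subst \<sigma> m = (\<Prod>i\<in>A. \<sigma> i ^ Poly_Mapping.lookup m i)"
  unfolding monomial_subst_def using assms by (intro prod.mono_neutral_left) (auto simp: in_keys_iff)

lemma monomial_subst_add: "monomial_subst \<sigma> (m + m') = monomial_subst \<sigma> m * monomial_subst
    \<sigma> m'"
proof -
  let ?A = "Poly_Mapping.keys m \<union> Poly_Mapping.keys m'"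
  have "Poly_Mapping.keys (m + m') \<subseteq> ?A" by (rule keys_add)
  then show ?thesis by (simp add: monomial_subst_eq[of ?A] lookup_add prod.distrib power_add)
qed

lemma subst_eq:
  assumes "finite A" "Poly_Mapping.keys p \<subseteq> A"
  shows "subst \<sigma> (p :: 'a::field mpoly) = (\<Sum>m\<in>A. pscale (Poly_Mapping.lookup p m)
      (monomial_subst \<sigma> m))"
  unfolding subst_def using assms by (intro sum.mono_neutral_left) (auto simp: in_keys_iff)

lemma subst_add: "subst \<sigma> (p + q :: 'a::field mpoly) = subst \<sigma> p + subst \<sigma> q"
proof -
  let ?A = "Poly_Mapping.keys p \<union> Poly_Mapping.keys q"
  have "Poly_Mapping.keys (p + q) \<subseteq> ?A" by (rule keys_add)
  then show ?thesis by (simp add: subst_eq[of ?A] lookup_add mpoly.scale_left_distrib sum.distrib)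
qed

lemma subst_pscale: "subst \<sigma> (pscale c p :: 'a::field mpoly) = pscale c (subst \<sigma> p)"
  unfolding subst_eq[OF finite_keys[of p] keys_pscale_subset[of c p]]
  by (simp add: subst_def mpoly.scale_sum_right)

lemma linear_subst: "Vector_Spaces.linear pscale pscale (subst \<sigma> :: 'a::field mpoly \<Rightarrow> _)"
  by unfold_locales (auto simp: subst_add subst_pscale)

lemma subst_single: "subst \<sigma> (Poly_Mapping.single m (c :: 'a::field)) = pscale c (monomial_subst
    \<sigma> m)"
  by (simp add: subst_eq[of "{m}"])

lemma subst_sum: "subst \<sigma> (\<Sum>x\<in>A. f x :: 'a::field mpoly) = (\<Sum>x\<in>A. subst \<sigma> (f x))"
  by (rule mpoly_pair.linear_sum[OF linear_subst])

lemma subst_mult: "subst \<sigma> (p * q :: 'a::field mpoly) = subst \<sigma> p * subst \<sigma> q"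
proof -
  let ?P = "Poly_Mapping.keys p" and ?Q = "Poly_Mapping.keys q"
  have "p * q = (\<Sum>m\<in>?P. Poly_Mapping.single m (Poly_Mapping.lookup p m)) * (\<Sum>m\<in>?Q.
      Poly_Mapping.single m (Poly_Mapping.lookup q m))"
    using poly_mapping_eq_sum_single[of ?P p] poly_mapping_eq_sum_single[of ?Q q] by simp
  also have "\<dots> = (\<Sum>m\<in>?P. \<Sum>m'\<in>?Q. Poly_Mapping.single (m + m') (Poly_Mapping.lookup p
      m * Poly_Mapping.lookup q m'))"
    by (simp add: sum_product mult_single)
  finally have "subst \<sigma> (p * q) = (\<Sum>m\<in>?P. \<Sum>m'\<in>?Q. pscale (Poly_Mapping.lookup p m *
      Poly_Mapping.lookup q m')
       (monomial_subst \<sigma> m * monomial_subst \<sigma> m'))"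
    by (simp add: subst_sum subst_single monomial_subst_add)
  also have "\<dots> = subst \<sigma> p * subst \<sigma> q"
    by (simp add: subst_def sum_product pscale_mult_pscale)
  finally show ?thesis .
qed

lemma monomial_subst_zero [simp]: "monomial_subst \<sigma> 0 = 1"
  by (simp add: monomial_subst_def)

lemma subst_Const: "subst \<sigma> (Const c) = (Const c :: 'a::field mpoly)"
  by (simp add: Const_def subst_single pscale_def)

lemma subst_one: "subst \<sigma> 1 = (1 :: 'a::field mpoly)"
  using subst_Const[of \<sigma> 1] by (simp add: Const_def)

lemma subst_Var: "subst \<sigma> (Var i) = (\<sigma> i :: 'a::field mpoly)"
  by (simp add: Var_def subst_single monomial_subst_def)

lemma subst_power: "subst \<sigma> (p ^ e :: 'a::field mpoly) = subst \<sigma> p ^ e"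
  by (induction e) (auto simp: subst_one subst_mult)

lemma subst_prod: "subst \<sigma> (\<Prod>x\<in>A. f x :: 'a::field mpoly) = (\<Prod>x\<in>A. subst \<sigma>
    (f x))"
  by (induction A rule: infinite_finite_induct) (auto simp: subst_one subst_mult)

lemma subst_subst: "subst \<tau> (subst \<sigma> p :: 'a::field mpoly) = subst (\<lambda>i. subst \<tau>
    (\<sigma> i)) p"
  by (simp add: subst_def[of \<sigma>] subst_def[of "\<lambda>i. subst \<tau> (\<sigma> i)"] subst_sum subst_pscale
      monomial_subst_def subst_prod subst_power)

lemma power_Var: "Var i ^ e = Poly_Mapping.single (Poly_Mapping.single i e) (1::'a::field)"
proof (induction e)
  case (Suc e)
  have "Var i ^ Suc e = Var i * (Var i ^ e :: 'a mpoly)" by simp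
  also have "\<dots> = Poly_Mapping.single (Poly_Mapping.single i 1 + Poly_Mapping.single i e) 1"
    unfolding Suc by (simp add: Var_def mult_single)
  also have "Poly_Mapping.single i 1 + Poly_Mapping.single i e = Poly_Mapping.single i (Suc e)"
    by (simp flip: single_add)
  finally show ?case .
qed simp

lemma prod_single:
  "(\<Prod>x\<in>A. Poly_Mapping.single (f x) (1::'a::field)) = Poly_Mapping.single (\<Sum>x\<in>A. f x ::
      nat \<Rightarrow>\<^sub>0 nat) 1"
  by (induction A rule: infinite_finite_induct) (auto simp: mult_single)

lemma monomial_subst_Var:
  assumes "\<And>i. i \<in> Poly_Mapping.keys m \<Longrightarrow> \<sigma> i = Var i"
  shows "monomial_subst \<sigma> m = Poly_Mapping.single m (1::'a::field)"
  using poly_mapping_eq_sum_single[of "Poly_Mapping.keys m" m] assms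
  by (simp add: monomial_subst_def power_Var prod_single)

lemma subst_ident:
  assumes "p \<in> polyring d" "\<And>i. i < d \<Longrightarrow> \<sigma> i = Var i"
  shows "subst \<sigma> p = (p :: 'a::field mpoly)"
proof -
  have "subst \<sigma> p = (\<Sum>m\<in>Poly_Mapping.keys p. pscale (Poly_Mapping.lookup p m)
      (Poly_Mapping.single m 1))"
    unfolding subst_def
  proof (intro sum.cong refl arg_cong[where f = "pscale _"] monomial_subst_Var)
    fix m i assume "m \<in> Poly_Mapping.keys p" "i \<in> Poly_Mapping.keys m"
    then show "\<sigma> i = Var i" using assms by (auto simp: polyring_def)
  qed
  also have "\<dots> = p" using poly_mapping_eq_sum_single[of "Poly_Mapping.keys p" p] by simp
  finally show ?thesis .
qed

section \<open>Hilbert functions of graded retracts\<close>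

lemma homog_zero [simp]: "homog d 0"
  by (simp add: homog_def)

lemma homog_add: "homog d p \<Longrightarrow> homog d q \<Longrightarrow> homog d (p + q)"
  unfolding homog_def using keys_add[of p q] by blast

lemma homog_sum: "(\<And>x. x \<in> A \<Longrightarrow> homog d (f x)) \<Longrightarrow> homog d
    (\<Sum>x\<in>A. f x)"
  by (induction A rule: infinite_finite_induct) (auto intro: homog_add)

lemma homog_pscale: "homog d p \<Longrightarrow> homog d (pscale c p)"
  unfolding homog_def using keys_pscale_subset[of c p] by blast

lemma homog_mult: "homog d p \<Longrightarrow> homog e q \<Longrightarrow> homog (d + e) (p * q)"
  unfolding homog_def using keys_mult[of p q] by (fastforce simp: mdeg_add)

lemma homog_one: "homog 0 1"
  by (simp add: homog_def)

lemma homog_power: "homog d p \<Longrightarrow> homog (int e * d) (p ^ e)"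
  by (induction e) (auto simp: homog_one distrib_right intro: homog_mult)

lemma homog_prod: "(\<And>x. x \<in> A \<Longrightarrow> homog (d x) (f x)) \<Longrightarrow> homog
    (\<Sum>x\<in>A. d x) (\<Prod>x\<in>A. f x)"
  by (induction A rule: infinite_finite_induct) (auto simp: homog_one intro: homog_mult)

lemma homog_subst:
  assumes "\<And>i. homog 1 (\<sigma> i)" "homog j p"
  shows "homog j (subst \<sigma> p)"
  unfolding subst_def
proof (intro homog_sum homog_pscale)
  fix m assume "m \<in> Poly_Mapping.keys p"
  then have j: "j = int (mdeg m)" using assms by (simp add: homog_def)
  have "homog (\<Sum>i\<in>Poly_Mapping.keys m. int (Poly_Mapping.lookup m i) * 1) (monomial_subst \<sigma> m)"
    unfolding monomial_subst_def by (intro homog_prod homog_power assms)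
  then show "homog j (monomial_subst \<sigma> m)" by (simp add: j mdeg_def)
qed

lemma polyring_add: "p \<in> polyring n \<Longrightarrow> q \<in> polyring n \<Longrightarrow> p + q \<in>
    polyring n"
  unfolding polyring_def using keys_add[of p q] by blast

lemma polyring_mult: "p \<in> polyring n \<Longrightarrow> q \<in> polyring n \<Longrightarrow> p * q \<in>
    polyring n"
  unfolding polyring_def
proof safe
  fix m i assume *: "\<forall>m\<in>Poly_Mapping.keys p. Poly_Mapping.keys m \<subseteq> {..<n}"
      "\<forall>m\<in>Poly_Mapping.keys q. Poly_Mapping.keys m \<subseteq> {..<n}"
    "m \<in> Poly_Mapping.keys (p * q)" "i \<in> Poly_Mapping.keys m"
  then obtain a b where "m = a + b" "a \<in> Poly_Mapping.keys p" "b \<in> Poly_Mapping.keys q"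
    using keys_mult[of p q] by blast
  then show "i < n" using * keys_add[of a b] by blast
qed

lemma zero_in_polyring: "0 \<in> polyring n"
  by (simp add: polyring_def)

lemma Const_in_polyring: "Const c \<in> polyring n"
  by (simp add: polyring_def Const_def)

lemma Var_in_polyring: "i < n \<Longrightarrow> Var i \<in> polyring n"
  by (simp add: polyring_def Var_def)

lemma homog_Var: "homog 1 (Var i :: 'a::field mpoly)"
  by (simp add: homog_def Var_def)

lemma polyring_pscale: "p \<in> polyring n \<Longrightarrow> pscale c p \<in> polyring n"
  unfolding polyring_def using keys_pscale_subset[of c p] by blast

lemma mdeg_eq_1_iff: "mdeg m = 1 \<longleftrightarrow> (\<exists>i. m = Poly_Mapping.single i 1)"
proof
  assume m: "mdeg m = 1"
  then have "(\<Sum>i\<in>Poly_Mapping.keys m. Poly_Mapping.lookup m i) = 1" by (simp add: mdeg_def)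
  then obtain i where i: "i \<in> Poly_Mapping.keys m" "Poly_Mapping.lookup m i = 1"
     "\<forall>j\<in>Poly_Mapping.keys m. i \<noteq> j \<longrightarrow> Poly_Mapping.lookup m j = 0"
    by (subst (asm) sum_eq_1_iff) auto
  then have "m = Poly_Mapping.single i 1"
    by (intro poly_mapping_eqI) (auto simp: lookup_single when_def in_keys_iff)
  then show "\<exists>i. m = Poly_Mapping.single i 1" by blast
qed auto

section \<open>Linear forms and the subalgebras they generate\<close>

lemma linear_forms_eq_span: "linear_forms n = mpoly.span (Var ` {..<n} :: 'a::field mpoly set)"
proof -
  let ?S = "(\<lambda>i. Poly_Mapping.single i (1::nat)) ` {..<n}"
  have "p \<in> linear_forms n \<longleftrightarrow> Poly_Mapping.keys p \<subseteq> ?S" for p :: "'a mpoly"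
  proof
    assume p: "p \<in> linear_forms n"
    show "Poly_Mapping.keys p \<subseteq> ?S"
    proof
      fix m assume m: "m \<in> Poly_Mapping.keys p"
      then have "mdeg m = 1" using p by (auto simp: linear_forms_def homog_def)
      then obtain i where "m = Poly_Mapping.single i 1" using mdeg_eq_1_iff[of m] by auto
      then show "m \<in> ?S" using p m by (auto simp: linear_forms_def polyring_def)
    qed
  next
    assume "Poly_Mapping.keys p \<subseteq> ?S"
    then show "p \<in> linear_forms n"
      by (fastforce simp: linear_forms_def polyring_def homog_def)
  qed
  then have "linear_forms n = {p :: 'a mpoly. Poly_Mapping.keys p \<subseteq> ?S}" by blast
  also have "\<dots> = mpoly.span ((\<lambda>m. Poly_Mapping.single m 1) ` ?S)"
    by (rule span_monomials[symmetric])
  also have "(\<lambda>m. Poly_Mapping.single m 1) ` ?S = (Var ` {..<n} :: 'a mpoly set)"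
    by (simp add: image_image Var_def)
  finally show ?thesis .
qed

lemma Var_inj: "inj_on (Var :: nat \<Rightarrow> 'a::field mpoly) A"
proof (rule inj_onI)
  fix i j assume "Var i = (Var j :: 'a mpoly)"
  then have "Poly_Mapping.single i (1::nat) = Poly_Mapping.single j 1"
    using inj_on_monomials[of UNIV, where 'a='a] by (auto simp: Var_def inj_def)
  then have "Poly_Mapping.keys (Poly_Mapping.single i (1::nat)) = Poly_Mapping.keys
      (Poly_Mapping.single j
      (1::nat))"
    by simp
  then show "i = j" by simp
qed

lemma independent_Var: "mpoly.independent (Var ` A :: 'a::field mpoly set)"
  using independent_monomials[of "(\<lambda>i. Poly_Mapping.single i 1) ` A", where 'a='a]
  by (simp add: image_image Var_def)

lemma alg_gen_sum: "(\<And>x. x \<in> A \<Longrightarrow> f x \<in> alg_gen L) \<Longrightarrow>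
    (\<Sum>x\<in>A. f x) \<in> alg_gen L"
proof (induction A rule: infinite_finite_induct)
  case (insert x F)
  then show ?case by (auto intro: alg_gen.add)
qed (use alg_gen.const[of 0] in \<open>auto simp: Const_def\<close>)

lemma alg_gen_one: "1 \<in> alg_gen L"
  using alg_gen.const[of 1] by (simp add: Const_def)

lemma alg_gen_power: "p \<in> alg_gen L \<Longrightarrow> p ^ e \<in> alg_gen L"
  by (induction e) (auto intro: alg_gen_one alg_gen.mult)

lemma alg_gen_prod: "(\<And>x. x \<in> A \<Longrightarrow> f x \<in> alg_gen L) \<Longrightarrow>
    (\<Prod>x\<in>A. f x) \<in> alg_gen L"
  by (induction A rule: infinite_finite_induct) (auto intro: alg_gen_one alg_gen.mult)

lemma subst_in_alg_gen:
  assumes "\<And>i. i < d \<Longrightarrow> \<sigma> i \<in> alg_gen L" "p \<in> polyring d"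
  shows "subst \<sigma> p \<in> alg_gen L"
  unfolding subst_def monomial_subst_def pscale_def
proof (intro alg_gen_sum alg_gen.mult alg_gen.const alg_gen_prod alg_gen_power assms(1))
  fix m i assume "m \<in> Poly_Mapping.keys p" "i \<in> Poly_Mapping.keys m"
  then show "i < d" using assms(2) by (auto simp: polyring_def)
qed

text \<open>Substituting a basis of the span of \<open>L\<close> for the variables has a left inverse, obtained by
  extending the inverse assignment to a linear map on all linear forms.\<close>

lemma pdim_component_alg_gen:
  fixes L :: "'a::field mpoly set"
  assumes L: "L \<subseteq> linear_forms n"
  shows "real (pdim (component (alg_gen L) j)) = hcoeff (int (mpoly.dim L)) j"
    and "mpoly.dim L \<le> n"
proof -
  obtain B where B: "B \<subseteq> L" "mpoly.independent B" "L \<subseteq> mpoly.span B" "card B = mpoly.dim L"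
    using mpoly.basis_exists by blast
  have BV: "B \<subseteq> mpoly.span (Var ` {..<n})" using B L linear_forms_eq_span by blast
  then have finB: "finite B" and cardB: "card B \<le> card (Var ` {..<n} :: 'a mpoly set)"
    using mpoly.independent_span_bound[of "Var ` {..<n}" B] B by auto
  have "card (Var ` {..<n} :: 'a mpoly set) = n" using Var_inj by (subst card_image) auto
  with cardB B show "mpoly.dim L \<le> n" by simp
  define d where "d = card B"
  obtain b where b: "bij_betw b {..<d} B" using finB ex_bij_betw_nat_finite[of B] by (auto simp: d_def
      lessThan_atLeast0)
  define \<sigma> where "\<sigma> i = (if i < d then b i else 0)" for i
  have bB: "b i \<in> B" if "i < d" for i using b that by (auto simp: bij_betw_def)
  have \<sigma>hom: "homog 1 (\<sigma> i)" for i using bB B L by (auto simp: \<sigma>_def linear_forms_def)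
  \<comment> \<open>An extension with controlled range is chosen: the range of g consists of linear
    forms, so the left inverse \<tau> also substitutes linear forms and preserves degrees.\<close>
  obtain g where g: "Vector_Spaces.linear pscale pscale g" "\<And>x. x \<in> B \<Longrightarrow> g x = Var
      (inv_into {..<d} b x)"
     "range g = mpoly.span ((\<lambda>x. Var (inv_into {..<d} b x)) ` B)"
    using mpoly_pair.linear_independent_extend_subspace[OF B(2), of "\<lambda>x. Var (inv_into {..<d} b x)"]
        by metis
  define \<tau> where "\<tau> i = g (Var i)" for i
  have "(\<lambda>x. Var (inv_into {..<d} b x)) ` B \<subseteq> Var ` {..<d}"
    using b inv_into_into[of _ b "{..<d}"] by (auto simp: bij_betw_def)
  then have "\<tau> i \<in> mpoly.span (Var ` {..<d})" for i
    using g(3) mpoly.span_mono unfolding \<tau>_def by blast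
  then have \<tau>hom: "homog 1 (\<tau> i)" for i
    using linear_forms_eq_span[of d, where 'a='a] by (auto simp: linear_forms_def)
  have \<tau>g: "subst \<tau> p = g p" if "p \<in> mpoly.span (Var ` {..<n})" for p
    by (rule mpoly_pair.linear_eq_on[OF linear_subst g(1) that]) (auto simp: subst_Var \<tau>_def)
  have \<tau>\<sigma>: "subst \<tau> (subst \<sigma> p) = p" if "p \<in> polyring d" for p
    unfolding subst_subst
  proof (rule subst_ident[OF that])
    fix i assume i: "i < d"
    have "subst \<tau> (\<sigma> i) = g (b i)" using i bB[OF i] BV \<tau>g by (auto simp: \<sigma>_def)
    also have "\<dots> = Var i" using g(2)[OF bB[OF i]] b i by (simp add: bij_betw_def inv_into_f_f)
    finally show "subst \<tau> (\<sigma> i) = Var i" .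
  qed
  have alg: "alg_gen L = subst \<sigma> ` polyring d"
  proof (intro equalityI subsetI)
    fix p assume "p \<in> alg_gen L"
    then show "p \<in> subst \<sigma> ` polyring d"
    proof induction
      case (gen p)
      have "mpoly.subspace (subst \<sigma> ` polyring d)"
        by (intro mpoly_pair.linear_subspace_image[OF linear_subst])
           (auto simp: mpoly.subspace_def polyring_add polyring_pscale, simp add: polyring_def)
      moreover have "B \<subseteq> subst \<sigma> ` polyring d"
      proof
        fix x assume "x \<in> B"
        then obtain i where "i < d" "x = b i" using b by (auto simp: bij_betw_def)
        then show "x \<in> subst \<sigma> ` polyring d"
          by (intro image_eqI[of _ _ "Var i"]) (auto simp: subst_Var \<sigma>_def Var_in_polyring)
      qed
      ultimately have "mpoly.span B \<subseteq> subst \<sigma> ` polyring d" by (intro mpoly.span_minimal)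
      then show ?case using gen B by auto
    next
      case (const c)
      then show ?case by (intro image_eqI[of _ _ "Const c"]) (auto simp: subst_Const Const_in_polyring)
    next
      case (add p q)
      then show ?case by (auto simp flip: subst_add intro!: imageI polyring_add)
    next
      case (mult p q)
      then show ?case by (auto simp flip: subst_mult intro!: imageI polyring_mult)
    qed
  next
    fix p assume "p \<in> subst \<sigma> ` polyring d"
    moreover have "\<sigma> i \<in> alg_gen L" if "i < d" for i
      using bB[OF that] B that by (auto simp: \<sigma>_def intro: alg_gen.gen)
    ultimately show "p \<in> alg_gen L" using subst_in_alg_gen[of d \<sigma> L] by blast
  qed
  define M where "M = {m. Poly_Mapping.keys m \<subseteq> {..<d} \<and> int (mdeg m) = j}"
  define P where "P = {p :: 'a mpoly. Poly_Mapping.keys p \<subseteq> M}"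
  have P: "P = {p \<in> polyring d. homog j p}"
    by (auto simp: P_def M_def polyring_def homog_def)
  have comp: "component (alg_gen L) j = subst \<sigma> ` P"
  proof (intro equalityI subsetI)
    fix x assume "x \<in> component (alg_gen L) j"
    then obtain p where p: "p \<in> polyring d" "x = subst \<sigma> p" "homog j x"
      by (auto simp: component_def alg)
    \<comment> \<open>Homogeneity passes from x back to p because p is the image of x under the
      degree-preserving substitution \<tau>.\<close>
    then have "homog j p" using homog_subst[of \<tau> j x] \<tau>hom \<tau>\<sigma>[of p] by auto
    then show "x \<in> subst \<sigma> ` P" using p P by auto
  next
    fix x assume "x \<in> subst \<sigma> ` P"
    then show "x \<in> component (alg_gen L) j"
      using homog_subst[of \<sigma> j] \<sigma>hom by (auto simp: component_def alg P)
  qed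
  let ?M = "(\<lambda>m. Poly_Mapping.single m (1::'a)) ` M"
  have spanM: "mpoly.span ?M = P" unfolding P_def by (rule span_monomials)
  have inj: "inj_on (subst \<sigma>) (mpoly.span ?M)"
    unfolding spanM by (rule inj_on_inverseI[of _ "subst \<tau>"]) (auto simp: \<tau>\<sigma> P)
  have "mpoly.span (subst \<sigma> ` ?M) = component (alg_gen L) j"
    unfolding comp mpoly_pair.linear_span_image[OF linear_subst] spanM ..
  then have "pdim (component (alg_gen L) j) = card (subst \<sigma> ` ?M)"
    using mpoly.dim_span_eq_card_independent[OF
        mpoly_pair.linear_independent_injective_image[OF linear_subst independent_monomials inj]]
    unfolding pdim_def by simp
  also have "\<dots> = card ?M"
    by (intro card_image inj_on_subset[OF inj] mpoly.span_superset)
  also have "\<dots> = card M" by (intro card_image inj_on_monomials)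
  also have "real (card M) = hcoeff (int d) j"
  proof (cases "j < 0")
    case True
    then have "M = {}" by (auto simp: M_def)
    then show ?thesis using True by simp
  next
    case False
    then have "M = {m. Poly_Mapping.keys m \<subseteq> {..<d} \<and> mdeg m = nat j}" by (auto simp: M_def)
    then have "card M = (d + nat j - 1) choose nat j" using card_monomials(1)[of "{..<d}" "nat j"]
        by simp
    then show ?thesis using hcoeff_of_nat[of d "nat j"] False by simp
  qed
  finally show "real (pdim (component (alg_gen L) j)) = hcoeff (int (mpoly.dim L)) j"
    using B d_def by simp
qed

text \<open>The coefficient of T in (1-T)^(-d) is d.\<close>

lemma retract_dim_eq:
  fixes L :: "'a::field mpoly set"
  assumes "L \<subseteq> linear_forms n"
  shows "retract_dim L = mpoly.dim L"
proof -
  have "real (retract_dim L) = hcoeff (int (mpoly.dim L)) 1"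
    unfolding retract_dim_def by (rule pdim_component_alg_gen(1)[OF assms])
  then show ?thesis by (simp add: hcoeff_def)
qed

lemma Var_subset_linear_forms: "d \<le> n \<Longrightarrow> Var ` {..<d} \<subseteq> (linear_forms n ::
    'a::field mpoly set)"
  by (auto simp: linear_forms_def Var_in_polyring homog_Var)

lemma dim_Var: "mpoly.dim (Var ` {..<d} :: 'a::field mpoly set) = d"
  using mpoly.dim_eq_card_independent[OF independent_Var[of "{..<d}", where 'a='a]] card_image[OF
      Var_inj[of
      "{..<d}", where 'a='a]]
  by simp

section \<open>The Koszul complex\<close>

interpretation ext: vector_space "\<lambda>c (x :: nat set \<Rightarrow> 'a::field mpoly) I. pscale c (x I)"
  by unfold_locales (auto simp: fun_eq_iff mpoly.scale_right_distrib mpoly.scale_left_distrib)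

interpretation ext_pair: vector_space_pair
  "\<lambda>c (x :: nat set \<Rightarrow> 'a::field mpoly) I. pscale c (x I)"
  "\<lambda>c (x :: nat set \<Rightarrow> 'a::field mpoly) I. pscale c (x I)"
  by unfold_locales

lemma sum_fun_apply: "(\<Sum>x\<in>A. f x) i = (\<Sum>x\<in>A. f x i)"
  by (induction A rule: infinite_finite_induct) auto

lemma linear_koszul_d:
  "Vector_Spaces.linear (\<lambda>c (x :: nat set \<Rightarrow> 'a::field mpoly) I. pscale c (x I))
      (\<lambda>c x I. pscale c (x I)) (koszul_d n)"
  by unfold_locales
     (auto simp: koszul_d_def fun_eq_iff sum.distrib algebra_simps pscale_def sum_distrib_left mult_ac)

text \<open>The terms for (i, j) and (j, i) with j < i cancel: inserting j first adds one element
  below i and flips the sign of i, while inserting i first does not affect the sign of j.\<close>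

lemma koszul_d_koszul_d: "koszul_d n (koszul_d n f) = 0"
proof
  fix I
  show "koszul_d n (koszul_d n f) I = 0 I"
  proof -
    define c where "c i J = card {j \<in> J. j < i}" for i :: nat and J
    define A where "A = {..<n} - I"
    define F where "F i j = (-1) ^ c i I * Var i * ((-1) ^ c j (insert i I) * Var j * f (insert j
        (insert i
        I)))" for i j
    have fin: "finite A" by (simp add: A_def)
    have "koszul_d n (koszul_d n f) I = (\<Sum>i\<in>A. \<Sum>j\<in>{..<n} - insert i I. F i j)"
      unfolding koszul_d_def A_def F_def c_def sum_distrib_left by (rule refl)
    also have "\<dots> = (\<Sum>i\<in>A. \<Sum>j\<in>A - {i}. F i j)"
      by (intro sum.cong) (auto simp: A_def)
    also have "\<dots> = (\<Sum>i\<in>A. (\<Sum>j\<in>{j\<in>A. j < i}. F i j) + (\<Sum>j\<in>{j\<in>A. i <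
        j}. F i j))"
    proof (intro sum.cong refl)
      fix i assume "i \<in> A"
      have *: "A - {i} = {j\<in>A. j < i} \<union> {j\<in>A. i < j}" by auto
      show "(\<Sum>j\<in>A - {i}. F i j) = (\<Sum>j\<in>{j\<in>A. j < i}. F i j) + (\<Sum>j\<in>{j\<in>A. i <
          j}. F i j)"
        unfolding * by (rule sum.union_disjoint) (use fin in auto)
    qed
    also have "\<dots> = (\<Sum>i\<in>A. \<Sum>j\<in>{j\<in>A. j < i}. F i j) + (\<Sum>i\<in>A.
        \<Sum>j\<in>{j\<in>A. i < j}. F i j)"
      by (rule sum.distrib)
    also have "(\<Sum>i\<in>A. \<Sum>j\<in>{j\<in>A. i < j}. F i j) = (\<Sum>j\<in>A. \<Sum>i\<in>{i\<in>A. i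
        < j}. F i j)"
      by (rule sum.swap_restrict[OF fin fin])
    also have "(\<Sum>i\<in>A. \<Sum>j\<in>{j\<in>A. j < i}. F i j) + (\<Sum>j\<in>A. \<Sum>i\<in>{i\<in>A. i
        < j}. F i j)
      = (\<Sum>i\<in>A. \<Sum>j\<in>{j\<in>A. j < i}. F i j + F j i)"
      by (simp add: sum.distrib)
    also have "\<dots> = 0"
    proof (intro sum.neutral ballI)
      fix i j assume i: "i \<in> A" and j: "j \<in> {j\<in>A. j < i}"
      then have fI: "finite {x\<in>I. x < i}" "finite {x\<in>I. x < j}" by (auto intro: finite_subset[of _
          "{..<i}"] finite_subset[of _ "{..<j}"])
      have "{x \<in> insert i I. x < j} = {x \<in> I. x < j}" using j by auto
      then have 1: "c j (insert i I) = c j I" by (simp add: c_def)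
      have "{x \<in> insert j I. x < i} = insert j {x \<in> I. x < i}" using j by auto
      then have 2: "c i (insert j I) = Suc (c i I)" using fI i j by (simp add: c_def A_def)
      show "F i j + F j i = 0"
        unfolding F_def 1 2 by (simp add: insert_commute mult_ac)
    qed
    finally show ?thesis by simp
  qed
qed

section \<open>Monomial generators and the graded components of the image\<close>

definition ext_monomial :: "(nat \<Rightarrow>\<^sub>0 nat) \<times> nat set \<Rightarrow> nat set
    \<Rightarrow> 'a::field mpoly" where
  "ext_monomial = (\<lambda>(m, I) J. if J = I then Poly_Mapping.single m 1 else 0)"

text \<open>Here \<open>q\<close> is the degree of the coefficient X^m alone; X^m e_I has degree q +
  k, hence the argument \<open>j - int k\<close> later on.\<close>

definition ext_monomials :: "nat \<Rightarrow> nat \<Rightarrow> int \<Rightarrow> ((nat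
    \<Rightarrow>\<^sub>0 nat) \<times> nat set) set" where
  "ext_monomials n k q = {(m, I). I \<subseteq> {..<n} \<and> card I = k \<and> Poly_Mapping.keys m
      \<subseteq> {..<n} \<and> int (mdeg m) = q}"

text \<open>The comparison of minima is written pointwise, so that m = 0, whose support has no
  minimum, counts as good.\<close>

definition good_monomials :: "nat \<Rightarrow> nat \<Rightarrow> int \<Rightarrow> ((nat
    \<Rightarrow>\<^sub>0 nat) \<times> nat set) set" where
  "good_monomials n k q = {(m, I) \<in> ext_monomials n k q. \<forall>i\<in>Poly_Mapping.keys m. Min I \<le> i}"

lemma minus_one_power_mpoly: "(-1) ^ e = (Poly_Mapping.single 0 ((-1) ^ e) :: 'a::field mpoly)"
proof (induction e)
  case (Suc e)
  have "(-1 :: 'a mpoly) = Poly_Mapping.single 0 (-1)"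
    by (simp add: single_uminus)
  then show ?case using Suc by (simp add: mult_single del: power_Suc add: power_Suc)
qed simp

lemma koszul_d_ext_monomial:
  assumes I: "I \<subseteq> {..<n}"
  shows "koszul_d n (ext_monomial (m, I)) =
    (\<Sum>i\<in>I. (\<lambda>J. pscale ((-1) ^ card {j\<in>I - {i}. j < i})
        (ext_monomial (m + Poly_Mapping.single i 1, I - {i}) J) :: 'a::field mpoly))"
proof
  fix J
  have "koszul_d n (ext_monomial (m, I)) J
      = (\<Sum>i\<in>{i\<in>I. J = I - {i}}. (-1) ^ card {j\<in>J. j < i} * Var i * Poly_Mapping.single m (1::'a))"
    unfolding koszul_d_def ext_monomial_def
    using I by (intro sum.mono_neutral_cong_right) auto
  also have "\<dots> = (\<Sum>i\<in>{i\<in>I. J = I - {i}}. Poly_Mapping.single (m + Poly_Mapping.single i 1)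
      ((-1) ^ card {j\<in>I - {i}. j < i}))"
    by (intro sum.cong refl) (auto simp: minus_one_power_mpoly Var_def mult_single add.commute)
  also have "\<dots> = (\<Sum>i\<in>I. pscale ((-1) ^ card {j\<in>I - {i}. j < i})
        (ext_monomial (m + Poly_Mapping.single i 1, I - {i}) J))"
    unfolding ext_monomial_def
    using I by (intro sum.mono_neutral_cong_left) (auto dest: finite_subset)
  finally show "koszul_d n (ext_monomial (m, I)) J = (\<Sum>i\<in>I. (\<lambda>J. pscale ((-1) ^ card
      {j\<in>I - {i}. j < i})
        (ext_monomial (m + Poly_Mapping.single i 1, I - {i}) J) :: 'a mpoly)) J"
    by (simp add: sum_fun_apply)
qed

text \<open>The differential raises coefficient degrees by exactly one. The predicate
  \<open>Q\<close> is general because this is applied both to "has degree d" and to "has degree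
  different from d".\<close>

lemma koszul_d_keys:
  assumes "\<And>J m. m \<in> Poly_Mapping.keys (f J) \<Longrightarrow> Q (Suc (mdeg m))" "m \<in>
      Poly_Mapping.keys (koszul_d n (f :: nat set \<Rightarrow> 'a::field mpoly) I)"
  shows "Q (mdeg m)"
proof -
  have "m \<in> (\<Union>i\<in>{..<n} - I. Poly_Mapping.keys ((-1) ^ card {j\<in>I. j < i} * Var i * f
      (insert i I)))"
    using subsetD[OF keys_sum assms(2)[unfolded koszul_d_def]] .
  then obtain i where "m \<in> Poly_Mapping.keys (((-1) ^ card {j\<in>I. j < i} * Var i) * f (insert i I))"
      by auto
  moreover have "(-1) ^ card {j\<in>I. j < i} * Var i = Poly_Mapping.single (Poly_Mapping.single i 1)
      ((-1::'a) ^ card {j\<in>I. j < i})"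
    by (simp add: minus_one_power_mpoly Var_def mult_single)
  ultimately have "m \<in> Poly_Mapping.keys (Poly_Mapping.single (Poly_Mapping.single i 1) ((-1::'a) ^ card
      {j\<in>I. j < i}) * f (insert i I))"
    by simp
  from subsetD[OF keys_mult this] have "m \<in> {a + b |a b. a \<in> Poly_Mapping.keys (Poly_Mapping.single
      (Poly_Mapping.single i 1) ((-1::'a) ^ card {j\<in>I. j < i})) \<and> b \<in> Poly_Mapping.keys (f
      (insert i I))}"
    .
  then obtain b where "m = Poly_Mapping.single i 1 + b" "b \<in> Poly_Mapping.keys (f (insert i I))"
    by (auto split: if_splits)
  then show ?thesis using assms(1)[of b "insert i I"] by (simp add: mdeg_add)
qed

lemma ext_module_iff:
  "f \<in> ext_module n k \<longleftrightarrow> (\<forall>I. f I \<in> polyring n) \<and> (\<forall>I. \<not>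
      (I \<subseteq> {..<n} \<and> card I = k) \<longrightarrow> f I = 0)"
  by (auto simp: ext_module_def)

lemma ext_module_homog_eq_span:
  "{f \<in> ext_module n k. \<forall>I. homog q (f I)} = ext.span (ext_monomial ` ext_monomials n k q :: (nat
      set \<Rightarrow> 'a::field mpoly) set)"
proof
  have "ext.subspace {f :: nat set \<Rightarrow> 'a mpoly. f \<in> ext_module n k \<and> (\<forall>I. homog q
      (f I))}"
    unfolding ext.subspace_def ext_module_iff
    by (simp add: homog_add homog_pscale polyring_add polyring_pscale zero_in_polyring)
  then show "ext.span (ext_monomial ` ext_monomials n k q :: (nat set \<Rightarrow> 'a mpoly) set)
      \<subseteq> {f \<in> ext_module n k. \<forall>I. homog q (f I)}"
    by (rule ext.span_minimal[rotated])
       (auto simp: ext_monomials_def ext_monomial_def ext_module_def polyring_def homog_def split: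
           if_splits)
  show "{f \<in> ext_module n k. \<forall>I. homog q (f I)} \<subseteq> ext.span (ext_monomial `
      ext_monomials n k q :: (nat set \<Rightarrow> 'a mpoly) set)"
  proof safe
    fix f :: "nat set \<Rightarrow> 'a mpoly" assume f: "f \<in> ext_module n k" "\<forall>I. homog q (f I)"
    let ?N = "{I. I \<subseteq> {..<n} \<and> card I = k}"
    have "finite ?N" by simp
    have "f = (\<Sum>I\<in>?N. \<Sum>m\<in>Poly_Mapping.keys (f I). (\<lambda>J. pscale (Poly_Mapping.lookup
        (f I) m) (ext_monomial (m, I) J)))"
    proof
      fix J
      have "(\<Sum>I\<in>?N. \<Sum>m\<in>Poly_Mapping.keys (f I). (\<lambda>J. pscale (Poly_Mapping.lookup (f
          I) m) (ext_monomial (m, I) J))) J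
         = (\<Sum>I\<in>?N. if J = I then f I else 0)"
        unfolding sum_fun_apply ext_monomial_def
        using poly_mapping_eq_sum_single[OF finite_keys subset_refl, of "f _"]
        by (intro sum.cong refl) auto
      also have "\<dots> = f J" using f \<open>finite ?N\<close> by (auto simp: ext_module_def)
      finally show "f J = (\<Sum>I\<in>?N. \<Sum>m\<in>Poly_Mapping.keys (f I). (\<lambda>J. pscale
          (Poly_Mapping.lookup (f I) m) (ext_monomial (m, I) J))) J"
        by simp
    qed
    also have "\<dots> \<in> ext.span (ext_monomial ` ext_monomials n k q)"
    proof (intro ext.span_sum ext.span_scale ext.span_base imageI)
      fix I m assume "I \<in> ?N" "m \<in> Poly_Mapping.keys (f I)"
      then show "(m, I) \<in> ext_monomials n k q"
        using f by (auto simp: ext_module_def ext_monomials_def polyring_def homog_def)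
    qed
    finally show "f \<in> ext.span (ext_monomial ` ext_monomials n k q)" .
  qed
qed

lemma poly_mapping_split:
  "\<exists>p1 p2. (p :: 'a::field mpoly) = p1 + p2 \<and> Poly_Mapping.keys p1 \<subseteq> {m \<in>
      Poly_Mapping.keys p. Q m} \<and>
     Poly_Mapping.keys p2 \<subseteq> {m \<in> Poly_Mapping.keys p. \<not> Q m}"
proof -
  let ?s = "\<lambda>A. \<Sum>m\<in>A. Poly_Mapping.single m (Poly_Mapping.lookup p m)"
  let ?A = "{m \<in> Poly_Mapping.keys p. Q m}" and ?B = "{m \<in> Poly_Mapping.keys p. \<not> Q m}"
  have "p = ?s (Poly_Mapping.keys p)" by (rule poly_mapping_eq_sum_single) auto
  also have "Poly_Mapping.keys p = ?A \<union> ?B" by auto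
  also have "?s (?A \<union> ?B) = ?s ?A + ?s ?B" by (rule sum.union_disjoint) auto
  finally have "p = ?s ?A + ?s ?B" .
  moreover have "Poly_Mapping.keys (?s A) \<subseteq> A" for A using keys_sum[of "\<lambda>m.
      Poly_Mapping.single m (Poly_Mapping.lookup p m)" A] by (auto split: if_splits)
  ultimately show ?thesis by blast
qed

text \<open>A homogeneous element x of the image has a homogeneous preimage: split a preimage into
  its part f1 of coefficient degree j - k and the rest f2. The image of f2 has no monomial in the
  degree in which x and the image of f1 live, so it is zero.\<close>

lemma Msyz_comp_eq_span_all:
  "Msyz_comp n k j = ext.span (koszul_d n ` ext_monomial ` ext_monomials n k (j - int k) :: (nat set
      \<Rightarrow> 'a::field mpoly) set)"
proof -
  let ?X = "{f \<in> ext_module n k. \<forall>I. homog (j - int k) (f I :: 'a mpoly)}"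
  have "Msyz_comp n k j = koszul_d n ` ?X"
  proof (intro equalityI subsetI)
    fix x assume "x \<in> koszul_d n ` ?X"
    then obtain f where f: "f \<in> ?X" "x = koszul_d n f" by auto
    have "homog (j - (int k - 1)) (x I)" for I
      unfolding homog_def
    proof
      fix m assume m: "m \<in> Poly_Mapping.keys (x I)"
      show "int (mdeg m) = j - (int k - 1)"
        by (rule koszul_d_keys[of f "\<lambda>d. int d = j - (int k - 1)" m n I]) (use f m in \<open>auto
            simp: homog_def\<close>)
    qed
    then show "x \<in> Msyz_comp n k j" using f by (auto simp: Msyz_comp_def Msyz_def)
  next
    fix x assume "x \<in> (Msyz_comp n k j :: (nat set \<Rightarrow> 'a mpoly) set)"
    then obtain f where f: "f \<in> ext_module n k" "x = koszul_d n f" and x: "\<And>I. homog (j - (int k -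
        1)) (x I)"
      by (auto simp: Msyz_comp_def Msyz_def)
    have "\<forall>I. \<exists>p1 p2. f I = p1 + p2 \<and> Poly_Mapping.keys p1 \<subseteq> {m \<in>
        Poly_Mapping.keys (f I). int (mdeg m) = j - int k} \<and>
         Poly_Mapping.keys p2 \<subseteq> {m \<in> Poly_Mapping.keys (f I). int (mdeg m) \<noteq> j - int k}"
      by (intro allI poly_mapping_split)
    then obtain f1 f2 where f12': "\<forall>I. f I = f1 I + f2 I \<and>
         Poly_Mapping.keys (f1 I) \<subseteq> {m \<in> Poly_Mapping.keys (f I). int (mdeg m) = j - int k} \<and>
         Poly_Mapping.keys (f2 I) \<subseteq> {m \<in> Poly_Mapping.keys (f I). int (mdeg m) \<noteq> j - int k}"
      unfolding choice_iff by (elim exE)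
    then have f12: "\<And>I. f I = f1 I + f2 I"
      "\<And>I. Poly_Mapping.keys (f1 I) \<subseteq> {m \<in> Poly_Mapping.keys (f I). int (mdeg m) = j - int k}"
      "\<And>I. Poly_Mapping.keys (f2 I) \<subseteq> {m \<in> Poly_Mapping.keys (f I). int (mdeg m) \<noteq>
          j - int k}"
      by blast+
    have "f1 I = 0" if "f I = 0" for I
      using f12(2)[of I] that by simp
    then have f1: "f1 \<in> ?X"
      using f f12(2) by (auto simp: ext_module_def polyring_def homog_def) blast+
    have "f = f1 + f2" using f12(1) by (auto simp: fun_eq_iff)
    then have sum: "x = koszul_d n f1 + koszul_d n f2"
      using f ext_pair.linear_add[OF linear_koszul_d] by auto
    have "koszul_d n f2 I = 0" for I
    proof -
      have k2: "int (mdeg m) \<noteq> j - (int k - 1)" if m: "m \<in> Poly_Mapping.keys (koszul_d n f2 I)" for m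
        by (rule koszul_d_keys[of f2 "\<lambda>d. int d \<noteq> j - (int k - 1)" m n I]) (use f12(3) m in auto)
      have k1: "int (mdeg m) = j - (int k - 1)" if m: "m \<in> Poly_Mapping.keys (koszul_d n f1 I)" for m
        by (rule koszul_d_keys[of f1 "\<lambda>d. int d = j - (int k - 1)" m n I]) (use f12(2) m in auto)
      have "m \<notin> Poly_Mapping.keys (koszul_d n f2 I)" for m
      proof
        assume m: "m \<in> Poly_Mapping.keys (koszul_d n f2 I)"
        then have "m \<notin> Poly_Mapping.keys (koszul_d n f1 I)" "m \<notin> Poly_Mapping.keys (x I)"
          using k1 k2 x[of I] by (auto simp: homog_def)
        then show False using m sum by (auto simp: in_keys_iff lookup_add)
      qed
      then have "Poly_Mapping.keys (koszul_d n f2 I) = {}" by blast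
      then show ?thesis by simp
    qed
    then have "x = koszul_d n f1" using sum by (auto simp: fun_eq_iff)
    then show "x \<in> koszul_d n ` ?X" using f1 by blast
  qed
  then show ?thesis
    unfolding ext_module_homog_eq_span ext_pair.linear_span_image[OF linear_koszul_d] .
qed

text \<open>For a good pair \<open>(m, I)\<close> with \<open>t = min I\<close>, the coefficient of \<open>X\<^sub>t X\<^sup>m e\<^bsub>I-t\<^esub>\<close> separates
  \<open>\<partial>(X\<^sup>m e\<^sub>I)\<close> from all the other \<open>\<partial>(X\<^bsup>m'\<^esup> e\<^bsub>I'\<^esub>)\<close> with \<open>(m', I')\<close> good.\<close>

lemma koszul_d_leading:
  fixes m m' :: "nat \<Rightarrow>\<^sub>0 nat"
  assumes k: "k > 0" and g: "(m, I) \<in> good_monomials n k q" and g': "(m', I') \<in> good_monomials n k q"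
  shows "Poly_Mapping.lookup (koszul_d n (ext_monomial (m', I')) (I - {Min I})) (m +
      Poly_Mapping.single (Min I) 1)
     = (if (m, I) = (m', I') then 1 else 0 :: 'a::field)"
proof -
  define t where "t = Min I"
  have I: "finite I" "I \<noteq> {}" "I \<subseteq> {..<n}" and I': "finite I'" "I' \<noteq> {}" "I'
      \<subseteq> {..<n}"
    using g g' k by (auto simp: good_monomials_def ext_monomials_def intro: finite_subset)
  have t: "t \<in> I" "\<And>i. i \<in> I \<Longrightarrow> t \<le> i" using I by (auto simp: t_def)
  have mt: "\<And>i. i \<in> Poly_Mapping.keys m \<Longrightarrow> t \<le> i" and mt': "\<And>i. i \<in>
      Poly_Mapping.keys m' \<Longrightarrow> Min I' \<le> i"
    using g g' by (auto simp: good_monomials_def t_def)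
  have same: "i = t \<and> (m, I) = (m', I')" if i: "i \<in> I'" "I - {t} = I' - {i}" "m' +
      Poly_Mapping.single i 1 = m + Poly_Mapping.single t 1" for i
  proof -
    \<comment> \<open>If i and t differ, comparing exponents puts t into the support of m' and i
      into that of m, so Min I' \<le> t \<le> i. As t is not in I', Min I' is smaller than t and
      differs from i; it then lies in I' - {i} = I - {t}, against the minimality of t.\<close>
    have "i = t"
    proof (rule ccontr)
      assume ne: "i \<noteq> t"
      have "Poly_Mapping.lookup (m' + Poly_Mapping.single i 1) x = Poly_Mapping.lookup (m +
          Poly_Mapping.single t 1) x" for x
        using i(3) by simp
      from this[of t] this[of i] have "t \<in> Poly_Mapping.keys m'" "i \<in> Poly_Mapping.keys m"
        using ne by (auto simp: lookup_add lookup_single in_keys_iff)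
      then have "Min I' \<le> t" "t \<le> i" using mt mt' by auto
      moreover have "t \<notin> I'" using i ne t by auto
      moreover have "Min I' \<in> I'" using I' by simp
      ultimately have "Min I' < t" by (metis le_neq_implies_less)
      then have "Min I' \<noteq> i" using \<open>t \<le> i\<close> by auto
      then have "Min I' \<in> I" using \<open>Min I' \<in> I'\<close> i by auto
      then show False using t \<open>Min I' < t\<close> by fastforce
    qed
    then show ?thesis using i t by auto
  qed
  have "Poly_Mapping.lookup (koszul_d n (ext_monomial (m', I')) (I - {t})) (m + Poly_Mapping.single t 1)
    = (\<Sum>i\<in>I'. (-1) ^ card {j\<in>I' - {i}. j < i} * (if I - {t} = I' - {i} \<and> m' +
        Poly_Mapping.single i 1 = m + Poly_Mapping.single t 1 then 1 else 0 :: 'a))"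
    unfolding koszul_d_ext_monomial[OF I'(3)] sum_fun_apply
    by (auto simp: lookup_sum ext_monomial_def lookup_single when_def intro!: sum.cong)
  also have "\<dots> = (if (m, I) = (m', I') then 1 else 0)"
  proof (cases "(m, I) = (m', I')")
    case True
    have "{j \<in> I - {t}. j < t} = {}" using t(2) by (auto simp: not_less)
    then have card0: "card {j \<in> I - {t}. j < t} = 0" by (simp only: card.empty)
    have "(\<Sum>i\<in>I. (-1) ^ card {j\<in>I - {i}. j < i} * (if I - {t} = I - {i} \<and> m +
        Poly_Mapping.single i 1 = m + Poly_Mapping.single t 1 then 1 else 0 :: 'a))
       = (\<Sum>i\<in>I. if i = t then 1 else 0)"
    proof (intro sum.cong refl)
      fix i assume "i \<in> I"
      then have "I - {t} = I - {i} \<longleftrightarrow> i = t" using t by blast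
      then show "(-1) ^ card {j\<in>I - {i}. j < i} * (if I - {t} = I - {i} \<and> m + Poly_Mapping.single i
          1 = m + Poly_Mapping.single t 1 then 1 else 0)
        = (if i = t then 1 else 0 :: 'a)"
        by (cases "i = t") (simp_all only: card0, simp_all)
    qed
    then show ?thesis using True I t by simp
  next
    case False
    then show ?thesis using same by (simp only: if_False) (intro sum.neutral, auto)
  qed
  finally show ?thesis unfolding t_def .
qed

lemma independent_koszul_d_good:
  assumes k: "k > 0"
  shows "ext.independent ((\<lambda>g. koszul_d n (ext_monomial g)) ` good_monomials n k q :: (nat set
      \<Rightarrow> 'a::field mpoly) set)"
    and "inj_on (\<lambda>g. koszul_d n (ext_monomial g) :: nat set \<Rightarrow> 'a mpoly) (good_monomials n k q)"
proof -
  let ?d = "\<lambda>g. koszul_d n (ext_monomial g) :: nat set \<Rightarrow> 'a mpoly"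
  define \<phi> where "\<phi> g x = Poly_Mapping.lookup (x (snd g - {Min (snd g)})) (fst g +
      Poly_Mapping.single (Min (snd g)) 1)"
    for g :: "(nat \<Rightarrow>\<^sub>0 nat) \<times> nat set" and x :: "nat set \<Rightarrow> 'a mpoly"
  have \<phi>: "\<phi> g (?d g') = (if g = g' then 1 else 0)" if "g \<in> good_monomials n k q" "g' \<in>
      good_monomials n k q" for g g'
    using koszul_d_leading[OF k, of "fst g" "snd g" n q "fst g'" "snd g'"] that by (simp add: \<phi>_def)
  show inj: "inj_on ?d (good_monomials n k q)"
  proof (rule inj_onI)
    fix g g' assume g: "g \<in> good_monomials n k q" "g' \<in> good_monomials n k q" "?d g = ?d g'"
    show "g = g'" using \<phi>[OF g(1) g(1)] \<phi>[OF g(1) g(2)] g(3) by (simp split: if_splits)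
  qed
  show "ext.independent (?d ` good_monomials n k q)"
  proof (rule ext.independent_if_coordinates)
    fix b assume "b \<in> ?d ` good_monomials n k q"
    then obtain g where g: "g \<in> good_monomials n k q" "b = ?d g" by auto
    show "\<exists>\<phi>. (\<forall>x y. \<phi> (x + y) = \<phi> x + \<phi> y) \<and> (\<forall>c x. \<phi>
        (\<lambda>I. pscale c (x I)) = c * \<phi> x) \<and>
      \<phi> b \<noteq> 0 \<and> (\<forall>b'\<in>?d ` good_monomials n k q - {b}. \<phi> b' = (0::'a))"
    proof (intro exI[of _ "\<phi> g"] conjI allI ballI)
      show "\<phi> g b \<noteq> 0" using \<phi>[OF g(1) g(1)] g by simp
      fix b' assume "b' \<in> ?d ` good_monomials n k q - {b}"
      then obtain g' where "g' \<in> good_monomials n k q" "b' = ?d g'" "g' \<noteq> g" using g by auto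
      then show "\<phi> g b' = 0" using \<phi>[OF g(1)] by auto
    qed (auto simp: \<phi>_def lookup_add)
  qed
qed

text \<open>For a pair that is not good let t be the least variable of m, so t < min I, and write
  X^m = X_t X^m'. Applying the differential twice to X^m' e_J with J = I \<union> {t} gives a
  relation whose term at t is, up to sign, the wanted element. Every other term keeps t in its index
  set, with no smaller variable in its coefficient, so it is good: a single rewriting step
  suffices.\<close>

lemma koszul_d_in_span_good:
  assumes k: "k > 0" and b: "(m, I) \<in> ext_monomials n k q"
  shows "koszul_d n (ext_monomial (m, I)) \<in>
    ext.span ((\<lambda>g. koszul_d n (ext_monomial g)) ` good_monomials n k q :: (nat set \<Rightarrow>
        'a::field mpoly) set)"
proof (cases "(m, I) \<in> good_monomials n k q")
  case True
  then show ?thesis by (intro ext.span_base imageI)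
next
  case False
  let ?d = "\<lambda>g. koszul_d n (ext_monomial g) :: nat set \<Rightarrow> 'a mpoly"
  let ?S = "ext.span (?d ` good_monomials n k q)"
  have I: "I \<subseteq> {..<n}" "card I = k" and m: "Poly_Mapping.keys m \<subseteq> {..<n}" "int (mdeg m) = q"
    using b by (auto simp: ext_monomials_def)
  have finI: "finite I" "I \<noteq> {}" using I k by (auto intro: finite_subset)
  from False b obtain i0 where i0: "i0 \<in> Poly_Mapping.keys m" "i0 < Min I"
    by (auto simp: good_monomials_def not_le)
  define t where "t = Min (Poly_Mapping.keys m)"
  have tm: "t \<in> Poly_Mapping.keys m" unfolding t_def using i0 by (intro Min_in) auto
  have tle: "\<And>i. i \<in> Poly_Mapping.keys m \<Longrightarrow> t \<le> i" by (auto simp: t_def)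
  have "t < Min I" using tle[OF i0(1)] i0(2) by simp
  then have tI: "\<And>i. i \<in> I \<Longrightarrow> t < i" using finI by simp
  then have tnI: "t \<notin> I" by auto
  define m' where "m' = m - Poly_Mapping.single t 1"
  have mm: "m = m' + Poly_Mapping.single t 1"
    using tm by (intro poly_mapping_eqI) (auto simp: m'_def lookup_add lookup_minus lookup_single
        when_def
        in_keys_iff)
  have km': "Poly_Mapping.keys m' \<subseteq> Poly_Mapping.keys m"
    by (auto simp: mm in_keys_iff lookup_add)
  define I' where "I' = insert t I"
  have I': "I' \<subseteq> {..<n}" "finite I'" using I finI m tm by (auto simp: I'_def)
  define s where "s i = ((-1) ^ card {j\<in>I' - {i}. j < i} :: 'a)" for i
  have "0 = koszul_d n (?d (m', I'))" by (simp add: koszul_d_koszul_d)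
  also have "\<dots> = (\<Sum>i\<in>I'. (\<lambda>J. pscale (s i) (?d (m' + Poly_Mapping.single i 1, I' -
      {i}) J)))"
    unfolding koszul_d_ext_monomial[OF I'(1)] s_def
    by (simp only: ext_pair.linear_sum[OF linear_koszul_d] ext_pair.linear_scale[OF linear_koszul_d])
  also have "\<dots> = (\<lambda>J. pscale (s t) (?d (m, I) J)) + (\<Sum>i\<in>I. (\<lambda>J. pscale (s i)
      (?d (m' + Poly_Mapping.single i 1, I' - {i}) J)))"
    unfolding I'_def using tnI finI mm by simp
  finally have eq: "(\<lambda>J. pscale (s t) (?d (m, I) J)) = - (\<Sum>i\<in>I. (\<lambda>J. pscale (s i)
      (?d (m' + Poly_Mapping.single i 1, I' - {i}) J)))"
    by (simp add: eq_neg_iff_add_eq_0)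
  have "(\<lambda>J. pscale (s t) (?d (m, I) J)) \<in> ?S"
    unfolding eq
  proof (intro ext.span_neg ext.span_sum ext.span_scale ext.span_base imageI)
    fix i assume i: "i \<in> I"
    have ti: "t \<in> I' - {i}" using i tnI by (auto simp: I'_def)
    have "Min (I' - {i}) = t"
      using ti I' tI by (intro Min_eqI) (auto simp: I'_def less_imp_le)
    moreover have "t \<le> x" if "x \<in> Poly_Mapping.keys (m' + Poly_Mapping.single i 1)" for x
      using that keys_add[of m' "Poly_Mapping.single i 1"] km' tle tI[OF i] by fastforce
    moreover have "card (I' - {i}) = k" using i finI tnI I by (simp add: I'_def)
    moreover have "Poly_Mapping.keys (m' + Poly_Mapping.single i 1) \<subseteq> {..<n}"
      using keys_add[of m' "Poly_Mapping.single i 1"] km' m i I by fastforce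
    moreover have "int (mdeg (m' + Poly_Mapping.single i 1)) = q"
      using m(2) mm by (simp add: mdeg_add)
    ultimately show "(m' + Poly_Mapping.single i 1, I' - {i}) \<in> good_monomials n k q"
      using I' by (auto simp: good_monomials_def ext_monomials_def)
  qed
  then have "(\<lambda>J. pscale (inverse (s t)) (pscale (s t) (?d (m, I) J))) \<in> ?S"
    by (rule ext.span_scale)
  then show ?thesis by (simp add: s_def)
qed

lemma Mdim_eq_card_good:
  assumes k: "k > 0"
  shows "Mdim n k j TYPE('a::field) = card (good_monomials n k (j - int k))"
proof -
  let ?d = "\<lambda>g. koszul_d n (ext_monomial g) :: nat set \<Rightarrow> 'a mpoly"
  let ?G = "good_monomials n k (j - int k)"
  have "(Msyz_comp n k j :: (nat set \<Rightarrow> 'a mpoly) set) = ext.span (?d ` ext_monomials n k (j - int k))"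
    by (simp add: Msyz_comp_eq_span_all image_image)
  also have "\<dots> = ext.span (?d ` ?G)"
  proof (rule ext.span_eq[THEN iffD2], intro conjI)
    show "?d ` ext_monomials n k (j - int k) \<subseteq> ext.span (?d ` ?G)"
      using koszul_d_in_span_good[OF k] by auto
    show "?d ` ?G \<subseteq> ext.span (?d ` ext_monomials n k (j - int k))"
      by (auto simp: good_monomials_def intro!: ext.span_base imageI)
  qed
  finally have "Mdim n k j TYPE('a) = ext.dim (ext.span (?d ` ?G))"
    by (simp add: Mdim_def)
  also have "\<dots> = card (?d ` ?G)"
    by (rule ext.dim_span_eq_card_independent[OF independent_koszul_d_good(1)[OF k]])
  also have "\<dots> = card ?G"
    by (rule card_image[OF independent_koszul_d_good(2)[OF k]])
  finally show ?thesis .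
qed

text \<open>Sort by t = min I: the other k - 1 indices come from the n - 1 - t larger ones, and m is
  any monomial of degree q in the n - t variables from t on.\<close>

lemma card_good_monomials:
  assumes k: "k > 0"
  shows "card (good_monomials n k (int q)) = (\<Sum>l<n. ((n - 1 - l) choose (k - 1)) * ((n - l + q - 1)
      choose q))"
proof -
  define A where "A t = {J. J \<subseteq> {t<..<n} \<and> card J = k - 1}" for t
  define B where "B t = {m. Poly_Mapping.keys m \<subseteq> {t..<n} \<and> mdeg m = q}" for t
  let ?f = "\<lambda>(t, J, m). (m, insert t J) :: (nat \<Rightarrow>\<^sub>0 nat) \<times> nat set"
  have Min_insert: "Min (insert t J) = t" if "J \<in> A t" for t J
    using that by (intro Min_eqI) (auto simp: A_def intro: finite_subset less_imp_le)
  have "bij_betw ?f (SIGMA t:{..<n}. A t \<times> B t) (good_monomials n k (int q))"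
    unfolding bij_betw_def
  proof (intro conjI equalityI subsetI)
    show "inj_on ?f (SIGMA t:{..<n}. A t \<times> B t)"
    proof (rule inj_onI)
      fix x y assume xy: "x \<in> (SIGMA t:{..<n}. A t \<times> B t)" "y \<in> (SIGMA t:{..<n}. A t \<times>
          B t)" "?f x = ?f y"
      obtain t J m t' J' m' where e: "x = (t, J, m)" "y = (t', J', m')" by (cases x; cases y) auto
      then have *: "J \<in> A t" "J' \<in> A t'" "insert t J = insert t' J'" "m = m'" using xy by auto
      then have "t = t'" using Min_insert by metis
      moreover have "t \<notin> J" "t' \<notin> J'" using * by (auto simp: A_def)
      ultimately show "x = y" using * e by auto
    qed
  next
    fix x assume "x \<in> ?f ` (SIGMA t:{..<n}. A t \<times> B t)"
    then obtain t J m where x: "x = (m, insert t J)" "t < n" "J \<in> A t" "m \<in> B t" by auto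
    moreover have "finite J" "t \<notin> J" using x by (auto simp: A_def intro: finite_subset)
    ultimately show "x \<in> good_monomials n k (int q)"
      using k Min_insert[of J t] by (auto simp: good_monomials_def ext_monomials_def A_def B_def)
  next
    fix x assume "x \<in> good_monomials n k (int q)"
    then obtain m I where x: "x = (m, I)" "I \<subseteq> {..<n}" "card I = k" "Poly_Mapping.keys m
        \<subseteq> {..<n}" "mdeg m = q"
      "\<And>i. i \<in> Poly_Mapping.keys m \<Longrightarrow> Min I \<le> i"
      by (auto simp: good_monomials_def ext_monomials_def)
    then have fin: "finite I" "I \<noteq> {}" using k by (auto intro: finite_subset)
    define t where "t = Min I"
    have "t \<in> I" unfolding t_def by (rule Min_in[OF fin])
    then have t: "t \<in> I" "t < n" using x by auto
    have "t < i" if "i \<in> I - {t}" for i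
      using that Min_le[OF fin(1), of i] unfolding t_def[symmetric] by auto
    then have "I - {t} \<in> A t" using x fin t by (auto simp: A_def)
    moreover have "m \<in> B t" using x by (auto simp: B_def t_def)
    ultimately show "x \<in> ?f ` (SIGMA t:{..<n}. A t \<times> B t)"
      using t x by (intro image_eqI[of _ _ "(t, I - {t}, m)"]) auto
  qed
  then have "card (good_monomials n k (int q)) = card (SIGMA t:{..<n}. A t \<times> B t)"
    by (simp add: bij_betw_same_card)
  also have "\<dots> = (\<Sum>t<n. card (A t \<times> B t))"
  proof (rule card_SigmaI)
    show "\<forall>t\<in>{..<n}. finite (A t \<times> B t)"
      using card_monomials(2) by (auto simp: A_def B_def)
  qed simp
  also have "\<dots> = (\<Sum>l<n. ((n - 1 - l) choose (k - 1)) * ((n - l + q - 1) choose q))"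
    using card_monomials(1)[of "{_..<n}" q] by (simp add: card_cartesian_product A_def B_def n_subsets)
  finally show ?thesis .
qed

lemma Mdim_eq:
  assumes k: "k > 0"
  shows "real (Mdim n k j TYPE('a::field)) = diff_coeff n k 0 (j - int k)"
proof (cases "j < int k")
  case True
  then have "good_monomials n k (j - int k) = {}" by (auto simp: good_monomials_def ext_monomials_def)
  then show ?thesis using True by (simp add: Mdim_eq_card_good[OF k] diff_coeff_def)
next
  case False
  then obtain q where q: "j - int k = int q" by (metis zero_le_imp_eq_int diff_ge_0_iff_ge not_less)
  have "diff_coeff n k 0 (int q) = (\<Sum>l<n. real ((n - 1 - l) choose (k - 1)) * real ((n - l + q - 1)
      choose q))"
    unfolding diff_coeff_def
  proof (intro sum.cong refl)
    fix l assume "l \<in> {..<n}"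
    then have "int n - int 0 - int l = int (n - l)" by auto
    then show "real ((n - 1 - l) choose (k - 1)) * hcoeff (int n - int 0 - int l) (int q) =
        real ((n - 1 - l) choose (k - 1)) * real ((n - l + q - 1) choose q)"
      by (simp only: hcoeff_of_nat)
  qed
  then show ?thesis unfolding Mdim_eq_card_good[OF k] q card_good_monomials[OF k] by simp
qed

section \<open>Hilbert decompositions\<close>

text \<open>Multiplication of a Laurent series by 1 - T, on the coefficient sequence; the r-th
  iterate is multiplication by (1-T)^r.\<close>

definition bdiff :: "(int \<Rightarrow> real) \<Rightarrow> int \<Rightarrow> real" where
  "bdiff u j = u j - u (j - 1)"

lemma funpow_bdiff_hcoeff: "(bdiff ^^ r) (\<lambda>j. hcoeff d (j - s)) = (\<lambda>j. hcoeff (d - int r) (j - s))"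
proof (induction r)
  case (Suc r)
  have "hcoeff (d - int r) (j - s) - hcoeff (d - int r) (j - 1 - s) = hcoeff (d - int (Suc r)) (j -
      s)" for j
    using hcoeff_diff[of "d - int r" "j - s"] by (simp add: algebra_simps)
  then show ?case using Suc by (simp add: bdiff_def fun_eq_iff)
qed simp

lemma funpow_bdiff_add: "(bdiff ^^ r) (\<lambda>j. u j + v j) = (\<lambda>j. (bdiff ^^ r) u j + (bdiff ^^ r) v j)"
  by (induction r) (auto simp: bdiff_def fun_eq_iff)

lemma funpow_bdiff_cmult: "(bdiff ^^ r) (\<lambda>j. c * u j) = (\<lambda>j. c * (bdiff ^^ r) u j)"
  by (induction r) (auto simp: bdiff_def fun_eq_iff algebra_simps)

lemma funpow_bdiff_zero: "(bdiff ^^ r) (\<lambda>j. 0) = (\<lambda>j. 0)"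
  by (induction r) (auto simp: bdiff_def fun_eq_iff)

lemma funpow_bdiff_sum: "(bdiff ^^ r) (\<lambda>j. \<Sum>x\<in>A. f x j) = (\<lambda>j. \<Sum>x\<in>A. (bdiff
    ^^ r) (f x) j)"
  by (induction A rule: infinite_finite_induct) (auto simp: funpow_bdiff_zero funpow_bdiff_add)

lemma funpow_bdiff_sum_list: "(bdiff ^^ r) (\<lambda>j. \<Sum>x\<leftarrow>xs. f x j) = (\<lambda>j.
    \<Sum>x\<leftarrow>xs. (bdiff ^^ r) (f x) j)"
  by (induction xs) (auto simp: funpow_bdiff_zero funpow_bdiff_add)

lemma funpow_bdiff_diff_coeff:
  "(bdiff ^^ r) (\<lambda>j. diff_coeff n k 0 (j - int k)) = (\<lambda>j. diff_coeff n k r (j - int k))"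
  unfolding diff_coeff_def funpow_bdiff_sum funpow_bdiff_cmult funpow_bdiff_hcoeff
  by (simp add: algebra_simps)

text \<open>On Laurent series 1 - T can be cancelled. Constant sequences lie in the kernel of
  \<open>bdiff\<close>; agreement far to the left excludes them.\<close>

lemma bdiff_eq_imp_eq:
  assumes "bdiff u = bdiff v" "\<And>j. j < N \<Longrightarrow> u j = v j"
  shows "u = v"
proof
  fix j
  show "u j = v j"
  proof (cases "j < N")
    case False
    then have "N \<le> j" by simp
    then show ?thesis
    proof (induction j rule: int_ge_induct)
      case base
      then show ?case using fun_cong[OF assms(1), of N] assms(2)[of "N - 1"] by (simp add: bdiff_def)
    next
      case (step i)
      then show ?case using fun_cong[OF assms(1), of "i + 1"] by (simp add: bdiff_def)
    qed
  qed (rule assms(2))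
qed

lemma funpow_bdiff_eq_imp_eq:
  assumes "(bdiff ^^ r) u = (bdiff ^^ r) v" "\<And>j. j < N \<Longrightarrow> u j = v j"
  shows "u = v"
  using assms(1)
proof (induction r)
  case (Suc r)
  have low: "(bdiff ^^ r) u j = (bdiff ^^ r) v j" if "j < N" for j
    using that
  proof (induction r arbitrary: j)
    case (Suc r)
    then show ?case by (simp add: bdiff_def)
  qed (use assms(2) in simp)
  have "bdiff ((bdiff ^^ r) u) = bdiff ((bdiff ^^ r) v)" using Suc.prems by simp
  from bdiff_eq_imp_eq[OF this low] have "(bdiff ^^ r) u = (bdiff ^^ r) v" .
  then show ?case by (rule Suc.IH)
qed simp

section \<open>The numerical criterion for Hilbert decompositions\<close>

lemma hilbert_decomp_iff:
  fixes fam :: "('a::field mpoly set \<times> int) list"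
  assumes "k > 0" "\<And>L s. (L, s) \<in> set fam \<Longrightarrow> L \<subseteq> linear_forms n"
  shows "hilbert_decomp n k fam \<longleftrightarrow>
    (\<forall>j. diff_coeff n k 0 (j - int k) = (\<Sum>(L, s)\<leftarrow>fam. hcoeff (int (mpoly.dim L)) (j - s)))"
proof -
  have "(\<Sum>(L, s)\<leftarrow>fam. hcoeff (int (mpoly.dim L)) (j - s)) = (\<Sum>(L, s)\<leftarrow>fam.
      real (pdim (component (alg_gen L) (j - s))))" for j
    using pdim_component_alg_gen(1)[OF assms(2)] by (intro arg_cong[where f = sum_list] map_cong) auto
  also have "\<dots> j = real (\<Sum>(L, s)\<leftarrow>fam. pdim (component (alg_gen L) (j - s)))" for j
    by (induction fam) auto
  finally have *: "(\<Sum>(L, s)\<leftarrow>fam. hcoeff (int (mpoly.dim L)) (j - s)) = real (\<Sum>(L,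
      s)\<leftarrow>fam. pdim (component (alg_gen L) (j - s)))" for j .
  show ?thesis
    unfolding hilbert_decomp_def * Mdim_eq[OF assms(1), where 'a = 'a, symmetric] of_nat_eq_iff
    using assms(2) by auto
qed

lemma decomp_depth_le_dim:
  assumes "hilbert_decomp n k fam" "(L, s) \<in> set fam"
  shows "decomp_depth fam \<le> mpoly.dim L"
proof -
  have "decomp_depth fam \<le> retract_dim L"
    unfolding decomp_depth_def using assms(2) by (intro Min_le) force+
  also have "\<dots> = mpoly.dim L"
    using assms by (intro retract_dim_eq[of _ n]) (auto simp: hilbert_decomp_def)
  finally show ?thesis .
qed

text \<open>Multiplication by (1-T)^r turns each summand of dimension d \<ge> r into a shift of
  (1-T)^(-(d-r)), whose coefficients are nonnegative.\<close>

lemma hilbert_decomp_imp_nonneg: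
  assumes "k > 0" "hilbert_decomp n k fam" "r \<le> decomp_depth fam"
  shows "diff_coeff n k r q \<ge> 0"
proof -
  have "\<forall>j. diff_coeff n k 0 (j - int k) = (\<Sum>(L, s)\<leftarrow>fam. hcoeff (int (mpoly.dim L))
      (j - s))"
    using assms(2) by (subst hilbert_decomp_iff[symmetric]) (use assms in \<open>auto simp:
        hilbert_decomp_def\<close>)
  then have "(\<lambda>j. diff_coeff n k 0 (j - int k)) = (\<lambda>j. \<Sum>x\<leftarrow>fam. hcoeff (int
      (mpoly.dim (fst x))) (j - snd x))"
    by (simp add: fun_eq_iff case_prod_unfold)
  then have "(bdiff ^^ r) (\<lambda>j. diff_coeff n k 0 (j - int k)) = (bdiff ^^ r) (\<lambda>j.
      \<Sum>x\<leftarrow>fam. hcoeff (int (mpoly.dim (fst x))) (j - snd x))"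
    by (rule arg_cong)
  then have "(\<lambda>j. diff_coeff n k r (j - int k)) = (bdiff ^^ r) (\<lambda>j. \<Sum>x\<leftarrow>fam.
      hcoeff (int (mpoly.dim (fst x))) (j - snd x))"
    by (simp only: funpow_bdiff_diff_coeff)
  also have "\<dots> = (\<lambda>j. \<Sum>x\<leftarrow>fam. hcoeff (int (mpoly.dim (fst x)) - int r) (j - snd x))"
    unfolding funpow_bdiff_sum_list funpow_bdiff_hcoeff ..
  finally have "diff_coeff n k r (q + int k - int k) = (\<Sum>x\<leftarrow>fam. hcoeff (int (mpoly.dim (fst
      x)) - int r) (q + int k - snd x))"
    by (rule fun_cong)
  also have "\<dots> \<ge> 0"
  proof (rule sum_list_nonneg, clarsimp)
    fix L s assume "(L, s) \<in> set fam"
    then have "r \<le> mpoly.dim L" using decomp_depth_le_dim assms(2,3) by fastforce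
    then show "hcoeff (int (mpoly.dim L) - int r) (q + int k - s) \<ge> 0" by (intro hcoeff_nonneg) auto
  qed
  finally show ?thesis by simp
qed

text \<open>With x = 1/(1-T), the geometric sum x + ... + x^e equals (x^e - 1)/T; so dropping the
  constant term of x^e and shifting yields powers of x again.\<close>

lemma hcoeff_Suc: "hcoeff (int e) (int (Suc q)) = (\<Sum>i\<leftarrow>[1..<Suc e]. hcoeff (int i) (int q))"
proof (induction e)
  case 0
  show ?case using hcoeff_of_nat[of 0 "Suc q"] by simp
next
  case (Suc e)
  have "hcoeff (int (Suc e)) (int (Suc q)) - hcoeff (int (Suc e)) (int q) = hcoeff (int e) (int (Suc q))"
    using hcoeff_diff[of "int (Suc e)" "int (Suc q)"] by simp
  then show ?case using Suc by simp
qed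

text \<open>The part of \<open>\<Sum>\<^sub>e (1-T)\<^bsup>-e\<^esup>\<close> in degrees at least \<open>N\<close> is again a finite sum of such series,
  shifted by \<open>N\<close>. This is what makes the decomposition finite.\<close>

lemma hcoeff_tail:
  assumes "\<And>e. e \<in> set E \<Longrightarrow> e \<le> B"
  shows "\<exists>E'. (\<forall>e\<in>set E'. e \<le> B) \<and>
    (\<forall>q. (\<Sum>e\<leftarrow>E. hcoeff (int e) (int (q + N))) = (\<Sum>e\<leftarrow>E'. hcoeff (int
        e) (int q)))"
proof (induction N)
  case 0
  then show ?case using assms by auto
next
  case (Suc N)
  then obtain E' where E': "\<And>e. e\<in>set E' \<Longrightarrow> e \<le> B"
    "\<And>q. (\<Sum>e\<leftarrow>E. hcoeff (int e) (int (q + N))) = (\<Sum>e\<leftarrow>E'. hcoeff (int e)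
        (int q))" by blast
  let ?E = "concat (map (\<lambda>e. [1..<Suc e]) E')"
  have "(\<Sum>e\<leftarrow>E. hcoeff (int e) (int (q + Suc N))) = (\<Sum>e\<leftarrow>E'. hcoeff (int e)
      (int (Suc q)))" for q
    using E'(2)[of "Suc q"] by simp
  also have "\<dots> q = (\<Sum>e\<leftarrow>?E. hcoeff (int e) (int q))" for q
    unfolding hcoeff_Suc by (induction E') (auto simp del: upt_Suc)
  finally have "\<forall>q. (\<Sum>e\<leftarrow>E. hcoeff (int e) (int (q + Suc N))) =
      (\<Sum>e\<leftarrow>?E. hcoeff (int e) (int q))" by blast
  moreover have "\<forall>e\<in>set ?E. e \<le> B" using E'(1) by fastforce
  ultimately show ?case by blast
qed

lemma pos_part_tail:
  assumes "r \<le> n"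
  shows "\<exists>E. (\<forall>e\<in>set E. e \<le> n - r) \<and> (\<forall>q. real (pos_part n k r (q + N))
      = (\<Sum>e\<leftarrow>E. hcoeff (int e) (int q)))"
proof -
  let ?E = "concat (map (\<lambda>l. replicate ((n - 1 - l) choose (k - 1)) (n - r - l)) [0..<n-r])"
  have *: "real (pos_part n k r q) = (\<Sum>e\<leftarrow>?E. hcoeff (int e) (int q))" for q
  proof -
    have "(\<Sum>e\<leftarrow>concat (map (\<lambda>l. replicate (c l) (f l)) xs). g e) =
        (\<Sum>l\<leftarrow>xs. real (c l) * g (f l))"
      for c f :: "nat \<Rightarrow> nat" and g :: "nat \<Rightarrow> real" and xs
      by (induction xs) (auto simp: sum_list_replicate)
    then have "(\<Sum>e\<leftarrow>?E. hcoeff (int e) (int q)) = (\<Sum>l\<leftarrow>[0..<n-r]. real ((n - 1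
        - l) choose (k - 1)) * hcoeff (int (n - r - l)) (int q))"
      by simp
    also have "\<dots> = (\<Sum>l<n-r. real ((n - 1 - l) choose (k - 1)) * hcoeff (int (n - r - l)) (int q))"
      by (simp add: interv_sum_list_conv_sum_set_nat lessThan_atLeast0)
    finally show ?thesis by (simp only: pos_part_def hcoeff_of_nat of_nat_sum of_nat_mult)
  qed
  have "e \<le> n - r" if "e \<in> set ?E" for e using that by auto
  from hcoeff_tail[of ?E, OF this, of N] show ?thesis by (simp only: *)
qed

lemma hcoeff_0_right [simp]: "hcoeff d 0 = 1"
  by (simp add: hcoeff_def)

lemma hcoeff_0_left: "hcoeff 0 q = (if q = 0 then 1 else 0)"
proof (cases "q \<le> 0")
  case False
  then have "hcoeff 0 q = real ((nat q - 1) choose nat q)" using hcoeff_of_nat[of 0 "nat q"] by simp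
  then show ?thesis using False by (simp add: binomial_eq_0)
qed auto

text \<open>In degrees below k + r each coefficient is realized one degree at a time, by copies of
  dimension r, whose series become single powers of T after multiplication by (1-T)^r. From degree k
  + r on the term \<open>r choose (k + q)\<close> vanishes, and the rest is a tail of
  \<open>pos_part\<close>, a finite sum of powers (1-T)^(-e) with e \<le> n - r, each realized in
  dimension e + r.\<close>

lemma nonneg_imp_numerical_decomp:
  assumes "k > 0" "r \<le> n" "\<And>q. diff_coeff n k r (int q) \<ge> 0"
  shows "\<exists>ds :: (nat \<times> int) list. (\<forall>(d, s)\<in>set ds. r \<le> d \<and> d \<le> n) \<and>
    (\<forall>j. diff_coeff n k r (j - int k) = (\<Sum>(d, s)\<leftarrow>ds. hcoeff (int d - int r) (j - s)))"
proof -
  obtain E where E: "\<And>e. e \<in> set E \<Longrightarrow> e \<le> n - r"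
    "\<And>q. real (pos_part n k r (q + r)) = (\<Sum>e\<leftarrow>E. hcoeff (int e) (int q))"
    using pos_part_tail[OF assms(2)] by blast
  define C where "C q = nat \<lfloor>diff_coeff n k r (int q)\<rfloor>" for q
  have C: "diff_coeff n k r (int q) = real (C q)" for q
  proof -
    have "diff_coeff n k r (int q) \<in> \<int>"
      unfolding diff_coeff_eq[OF assms(2,1)] by simp
    then show ?thesis using assms(3)[of q] by (auto simp: C_def elim!: Ints_cases)
  qed
  let ?ds1 = "concat (map (\<lambda>q. replicate (C q) (r, int k + int q)) [0..<r])"
  let ?ds2 = "map (\<lambda>e. (e + r, int k + int r)) E"
  have 1: "(\<Sum>(d, s)\<leftarrow>?ds1. hcoeff (int d - int r) (j - s)) = (\<Sum>q<r. if j - int k = int q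
      then real (C q) else 0)" for j
  proof -
    have "(\<Sum>e\<leftarrow>concat (map (\<lambda>l. replicate (C l) (f l)) xs). g e) =
        (\<Sum>l\<leftarrow>xs. real (C l) * g (f l))"
      for f :: "nat \<Rightarrow> nat \<times> int" and g :: "nat \<times> int \<Rightarrow> real" and xs
      by (induction xs) (auto simp: sum_list_replicate)
    then have "(\<Sum>(d, s)\<leftarrow>?ds1. hcoeff (int d - int r) (j - s)) = (\<Sum>q\<leftarrow>[0..<r].
        real (C q) * hcoeff 0 (j - (int k + int q)))"
      by simp
    also have "\<dots> = (\<Sum>q<r. real (C q) * hcoeff 0 (j - (int k + int q)))"
      by (simp add: interv_sum_list_conv_sum_set_nat lessThan_atLeast0)
    also have "\<dots> = (\<Sum>q<r. if j - int k = int q then real (C q) else 0)"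
      by (intro sum.cong refl) (auto simp: hcoeff_0_left)
    finally show ?thesis .
  qed
  have 2: "(\<Sum>(d, s)\<leftarrow>?ds2. hcoeff (int d - int r) (j - s)) = (\<Sum>e\<leftarrow>E. hcoeff
      (int e) (j - int k - int r))" for j
    by (simp add: o_def algebra_simps)
  have "diff_coeff n k r (j - int k) = (\<Sum>(d, s)\<leftarrow>?ds1 @ ?ds2. hcoeff (int d - int r) (j - s))" for j
  proof (cases "j < int k + int r")
    case True
    then have "(\<Sum>e\<leftarrow>E. hcoeff (int e) (j - int k - int r)) = 0" by (simp add: sum_list_0)
    moreover have "(\<Sum>q<r. if j - int k = int q then real (C q) else 0) = diff_coeff n k r (j - int k)"
    proof (cases "j < int k")
      case True
      then show ?thesis by (simp add: diff_coeff_def)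
    next
      case False
      then obtain q where "j - int k = int q" by (metis zero_le_imp_eq_int diff_ge_0_iff_ge not_less)
      then show ?thesis using True C by simp
    qed
    ultimately show ?thesis unfolding map_append sum_list_append 1 2 by simp
  next
    case False
    define q where "q = nat (j - int k - int r)"
    have q: "j - int k = int (q + r)" "j - int k - int r = int q" using False by (auto simp: q_def)
    have "(\<Sum>q<r. if j - int k = int q then real (C q) else 0) = 0"
      by (intro sum.neutral) (auto simp: q)
    moreover have "diff_coeff n k r (j - int k) = real (pos_part n k r (q + r))"
      unfolding q(1) diff_coeff_eq[OF assms(2,1)] using assms(1) by (simp add: binomial_eq_0)
    ultimately show ?thesis unfolding map_append sum_list_append 1 2 q(2) E(2) by simp
  qed
  moreover have "\<forall>(d, s)\<in>set (?ds1 @ ?ds2). r \<le> d \<and> d \<le> n"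
    using E(1) assms(2) by fastforce
  ultimately show ?thesis by blast
qed

text \<open>The summand l = n - k already contributes 1. This makes the constructed family nonempty,
  so that its depth is a minimum over a nonempty set.\<close>

lemma diff_coeff_0_pos:
  assumes "k > 0" "k \<le> n"
  shows "diff_coeff n k r 0 > 0"
proof -
  have "real ((n - 1 - (n - k)) choose (k - 1)) \<le> (\<Sum>l<n. real ((n - 1 - l) choose (k - 1)))"
    using assms by (intro member_le_sum) auto
  moreover have "n - 1 - (n - k) = k - 1" using assms by auto
  ultimately show ?thesis by (simp add: diff_coeff_def)
qed

text \<open>The numerical decomposition gives the Hilbert series only after multiplication by
  (1-T)^r. The factor is cancelled because both sides vanish below all shifts and below degree k.
  Polynomial rings in the first d variables realize the dimensions.\<close>

lemma nonneg_imp_hilbert_decomp: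
  assumes "k > 0" "k \<le> n" "r \<le> n" "\<And>q. diff_coeff n k r (int q) \<ge> 0"
  shows "\<exists>fam :: ('a::field mpoly set \<times> int) list. fam \<noteq> [] \<and> hilbert_decomp n k
      fam \<and> r \<le> decomp_depth fam"
proof -
  obtain ds :: "(nat \<times> int) list" where ds: "\<And>d s. (d, s) \<in> set ds \<Longrightarrow> r \<le>
      d \<and> d \<le> n"
    "\<And>j. diff_coeff n k r (j - int k) = (\<Sum>(d, s)\<leftarrow>ds. hcoeff (int d - int r) (j - s))"
    using nonneg_imp_numerical_decomp[OF assms(1,3,4)] by fast
  define fam :: "('a mpoly set \<times> int) list" where "fam = map (\<lambda>(d, s). (Var ` {..<d}, s)) ds"
  have "ds \<noteq> []" using ds(2)[of "int k"] diff_coeff_0_pos[OF assms(1,2), of r] by auto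
  then have ne: "fam \<noteq> []" by (simp add: fam_def)
  have lin: "L \<subseteq> linear_forms n" if "(L, s) \<in> set fam" for L s
    using that ds(1) Var_subset_linear_forms by (fastforce simp: fam_def)
  let ?u = "\<lambda>j. diff_coeff n k 0 (j - int k)" and ?v = "\<lambda>j. \<Sum>x\<leftarrow>ds. hcoeff
      (int (fst x)) (j - snd x)"
  have "(bdiff ^^ r) ?u = (bdiff ^^ r) ?v"
    unfolding funpow_bdiff_diff_coeff funpow_bdiff_sum_list funpow_bdiff_hcoeff
    using ds(2) by (simp add: case_prod_unfold)
  moreover define N where "N = Min (insert (int k) (snd ` set ds))"
  have "?u j = ?v j" if "j < N" for j
  proof -
    have j: "j < int k" "\<And>x. x \<in> set ds \<Longrightarrow> j < snd x" using that by (auto simp: N_def)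
    have "?v j = (\<Sum>x\<leftarrow>ds. 0)" using j(2) by (intro arg_cong[where f = sum_list] map_cong) auto
    moreover have "?u j = 0" using j(1) by (simp add: diff_coeff_def)
    ultimately show ?thesis by simp
  qed
  ultimately have "?u = ?v" by (rule funpow_bdiff_eq_imp_eq)
  then have "hilbert_decomp n k fam"
    by (subst hilbert_decomp_iff[OF assms(1) lin])
       (auto simp: fam_def o_def case_prod_unfold dim_Var fun_eq_iff)
  moreover have "r \<le> decomp_depth fam"
    unfolding decomp_depth_def
  proof (rule Min.boundedI)
    fix x assume "x \<in> (\<lambda>(L, s). retract_dim L) ` set fam"
    then obtain d s where "(d, s) \<in> set ds" "x = retract_dim (Var ` {..<d} :: 'a mpoly set)"
      by (auto simp: fam_def)
    then show "r \<le> x" using ds(1) retract_dim_eq[OF Var_subset_linear_forms, of d n, where 'a = 'a] by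
        (simp add: dim_Var)
  qed (use ne in auto)
  ultimately show ?thesis using ne by blast
qed

section \<open>The maximum over all decompositions\<close>

lemma decomp_depth_le:
  assumes "fam \<noteq> []" "hilbert_decomp n k fam"
  shows "decomp_depth fam \<le> n"
proof -
  obtain L s where Ls: "(L, s) \<in> set fam" using assms(1) by (cases fam) auto
  then have "L \<subseteq> linear_forms n" using assms(2) by (auto simp: hilbert_decomp_def)
  then show ?thesis using decomp_depth_le_dim[OF assms(2) Ls] pdim_component_alg_gen(2) by (meson
      order_trans)
qed

lemma finite_depths:
  "finite {decomp_depth fam | fam :: ('a::field mpoly set \<times> int) list. fam \<noteq> [] \<and>
      hilbert_decomp n k fam}"
  by (rule finite_subset[of _ "{..n}"]) (auto dest: decomp_depth_le)

lemma Hdepth1_ge: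
  assumes "k > 0" "k \<le> n" "r \<le> n" "\<And>q. diff_coeff n k r (int q) \<ge> 0"
  shows "r \<le> Hdepth1 TYPE('a::field) n k"
proof -
  obtain fam :: "('a mpoly set \<times> int) list" where "fam \<noteq> []" "hilbert_decomp n k fam" "r \<le>
      decomp_depth fam"
    using nonneg_imp_hilbert_decomp[OF assms] by blast
  then show ?thesis
    unfolding Hdepth1_def by (intro order_trans[OF _ Max_ge[OF finite_depths]]) auto
qed

lemma Hdepth1_less:
  assumes "k > 0" "k \<le> n" "diff_coeff n k r q < 0"
  shows "Hdepth1 TYPE('a::field) n k < r"
proof -
  \<comment> \<open>The case r = 0 provides some decomposition, so the maximum is over a nonempty
    set.\<close>
  have "diff_coeff n k 0 (int q) \<ge> 0" for q
    unfolding diff_coeff_def by (intro sum_nonneg mult_nonneg_nonneg hcoeff_nonneg) auto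
  then have "\<exists>fam :: ('a mpoly set \<times> int) list. fam \<noteq> [] \<and> hilbert_decomp n k fam"
    using nonneg_imp_hilbert_decomp[OF assms(1,2), of 0] by blast
  moreover have "decomp_depth fam < r" if "hilbert_decomp n k fam" for fam :: "('a mpoly set \<times> int) list"
    using hilbert_decomp_imp_nonneg[OF assms(1) that, of r q] assms(3) by (cases "r \<le> decomp_depth
        fam") auto
  ultimately show ?thesis
    unfolding Hdepth1_def by (subst Max_less_iff[OF finite_depths]) auto
qed

section \<open>Asymptotics\<close>

text \<open>With p = q + 1 the possibly negative term is \<open>r choose (k - 1 + p)\<close>.
  Multiplied by \<open>(k - 1 + p) choose (k - 1)\<close> it splits off a factor at most
  \<open>r choose (k - 1)\<close>, and the lower bound for \<open>pos_part\<close> applies. The term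
  is bounded in absolute value, so the parity of q does not enter.\<close>

lemma diff_coeff_nonnegI:
  assumes "r \<le> n" "k > 0" "\<And>p. r choose p \<le> ((k - 1 + p) choose (k - 1)) * ((n - r + p - 1) choose p)"
  shows "diff_coeff n k r (int q) \<ge> 0"
proof -
  define K where "K = k - 1"
  define p where "p = Suc q"
  have kq: "k + q = K + p" using assms(2) by (simp add: K_def p_def)
  have "(r choose (K + p)) * ((K + p) choose K) = (r choose p) * ((r - p) choose K)"
    by (rule choose_split)
  also have "\<dots> \<le> (((K + p) choose K) * ((n - r + p - 1) choose p)) * (r choose K)"
    using assms(3)[of p] by (intro mult_mono binomial_right_mono) (auto simp: K_def)
  also have "\<dots> = ((r choose K) * ((n - r + p - 1) choose p)) * ((K + p) choose K)" by simp
  finally have "r choose (k + q) \<le> (r choose K) * ((n - r + p - 1) choose p)"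
    unfolding kq by (simp add: mult_le_cancel2)
  also have "\<dots> \<le> pos_part n k r q"
    using pos_part_ge[OF assms(1), of k q] by (simp add: K_def p_def)
  finally have "real (r choose (k + q)) \<le> real (pos_part n k r q)" by simp
  then show ?thesis
    unfolding diff_coeff_eq[OF assms(1,2)] by (cases "even q") auto
qed

text \<open>The contrapositive of \<open>exp_le_of_choose_le\<close>; p is even, so p - 1 is odd and
  the binomial enters with a minus sign.\<close>

lemma diff_coeff_negI:
  fixes n r K a p :: nat
  assumes "r < n" "2 * r = n + a" "p = 2 * (a div 4)" "a \<ge> 4" "2 * K \<le> n"
    and "real (2 * K * (K + p)) ^ K < exp (((real a)\<^sup>2 / 2 - 8) / real n)"
  shows "diff_coeff n (Suc K) r (int (p - 1)) < 0"
proof -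
  have p: "p \<ge> 2" "even p" using assms(3,4) by auto
  then have odd: "odd (p - 1)" by simp
  have "r choose (Suc K + (p - 1)) > (n choose K) * ((n - r + p - 1) choose p)"
    using exp_le_of_choose_le[OF assms(1,2,3,5)] assms(6) p by fastforce
  moreover have "pos_part n (Suc K) r (p - 1) \<le> (n choose K) * ((n - r + p - 1) choose p)"
    using pos_part_le[of r n "Suc K" "p - 1"] assms(1) p by simp
  ultimately have "pos_part n (Suc K) r (p - 1) < r choose (Suc K + (p - 1))" by simp
  then have "real (pos_part n (Suc K) r (p - 1)) < real (r choose (Suc K + (p - 1)))" by (simp only:
      of_nat_less_iff)
  moreover have "diff_coeff n (Suc K) r (int (p - 1)) = real (pos_part n (Suc K) r (p - 1)) - real
      (r choose
      (Suc K + (p - 1)))"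
    using diff_coeff_eq[of r n "Suc K" "p - 1"] assms(1) odd by simp
  ultimately show ?thesis by simp
qed

text \<open>The target value of \<open>2 r - n\<close>; the claim is the case \<open>c = sqrt (k-1)\<close>, \<open>d = c/2\<close>.\<close>

definition excess :: "real \<Rightarrow> real \<Rightarrow> nat \<Rightarrow> real" where
  "excess c d n = c * sqrt (real n * ln (real n)) + d * (sqrt (real n / ln (real n)) * ln (ln (real n)))"

text \<open>With c^2 = K the logarithm bounds that of 2K(K+p) for p \<le> a/2. Both sides start with
  (c^2/2) ln n; the next terms are (c^2/2) ln ln n on the left and c d ln ln n on the right, so d =
  c/2 is the threshold.\<close>

lemma eventually_excess_upper:
  fixes c d :: real
  assumes "c > 0" "d > c / 2"
  shows "eventually (\<lambda>n. c\<^sup>2 * ln (2 * c\<^sup>2 * (c\<^sup>2 + excess c d n / 2 + 1)) <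
      ((excess c d n)\<^sup>2 / 2 - 8) / real n) at_top"
proof -
  have "((\<lambda>n. (((excess c d n)\<^sup>2 / 2 - 8) / real n - c\<^sup>2 * ln (2 * c\<^sup>2 * (c\<^sup>2
      + excess c d n / 2 + 1))) / ln (ln n))
      \<longlongrightarrow> c * d - c\<^sup>2 / 2) at_top"
    unfolding excess_def using assms by (real_asymp simp: field_simps power2_eq_square)
  moreover have "c * d - c\<^sup>2 / 2 > 0" using assms by (simp add: power2_eq_square)
  ultimately have "eventually (\<lambda>n. 0 < (((excess c d n)\<^sup>2 / 2 - 8) / real n - c\<^sup>2 * ln (2
      * c\<^sup>2 * (c\<^sup>2 + excess c d n / 2 + 1))) / ln (ln n)) at_top"
    by (rule order_tendstoD(1))
  moreover have "eventually (\<lambda>n::nat. ln (ln n) > 0) at_top" by real_asymp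
  ultimately show ?thesis by eventually_elim (simp add: zero_less_divide_iff)
qed

text \<open>Both sides start with c^2 n ln n; the coefficients of n ln ln n are 2 c d on the left
  and c^2 on the right, which again gives the threshold d = c/2.\<close>

lemma eventually_excess_lower:
  fixes c d :: real
  assumes "c > 0" "0 < d" "d < c / 2"
  shows "eventually (\<lambda>n. (excess c d n + 1)\<^sup>2 < 2 * (real n - excess c d n) * (c\<^sup>2 * ln
      (1 + (excess c d n - 2) / (4 * c\<^sup>2)))) at_top"
proof -
  have "((\<lambda>n. (2 * (real n - excess c d n) * (c\<^sup>2 * ln (1 + (excess c d n - 2) / (4 *
      c\<^sup>2))) - (excess c d n + 1)\<^sup>2) / (n * ln (ln n)))
      \<longlongrightarrow> c\<^sup>2 - 2 * c * d) at_top"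
    unfolding excess_def using assms by (real_asymp simp: field_simps power2_eq_square)
  moreover have "c\<^sup>2 - 2 * c * d > 0" using assms by (simp add: power2_eq_square)
  ultimately have "eventually (\<lambda>n::nat. 0 < (2 * (real n - excess c d n) * (c\<^sup>2 * ln (1 +
      (excess c d n - 2) / (4 * c\<^sup>2))) - (excess c d n + 1)\<^sup>2) / (n * ln (ln n))) at_top"
    by (rule order_tendstoD(1))
  moreover have "eventually (\<lambda>n::nat. n * ln (ln n) > 0) at_top" by real_asymp
  ultimately show ?thesis by eventually_elim (simp add: zero_less_divide_iff)
qed

text \<open>Above 4 makes p = 2 * (a div 4) at least 2 and excess^2/2 - 8 positive; below n - 2
  keeps r < n even after rounding up. For c = 0 growth comes from the second term of
  \<open>excess\<close> alone.\<close>

lemma eventually_excess_bounds: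
  fixes c d :: real
  assumes "c \<ge> 0" "d > 0"
  shows "eventually (\<lambda>n. 4 < excess c d n \<and> excess c d n < real n - 2) at_top"
proof (cases "c = 0")
  case True
  then show ?thesis unfolding excess_def eventually_conj_iff
    using assms by (intro conjI; simp) real_asymp+
next
  case False
  then have "c > 0" using assms by simp
  then show ?thesis unfolding excess_def eventually_conj_iff
    using assms by (intro conjI) real_asymp+
qed

lemma eventually_Hdepth1_less:
  fixes d :: real
  assumes d: "d > sqrt (real K) / 2" "d > 0"
  shows "eventually (\<lambda>n. real (Hdepth1 TYPE('a::field) n (Suc K)) < (real n + excess (sqrt (real K))
      d n) / 2) at_top"
proof -
  define c where "c = sqrt (real K)"
  have c: "c \<ge> 0" "c\<^sup>2 = real K" by (auto simp: c_def)
  have "eventually (\<lambda>n. K = 0 \<or> c\<^sup>2 * ln (2 * c\<^sup>2 * (c\<^sup>2 + excess c d n / 2 +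
      1)) < ((excess c d n)\<^sup>2 / 2 - 8) / real n) at_top"
  proof (cases "K = 0")
    case False
    then have "c > 0" by (simp add: c_def)
    then show ?thesis using eventually_excess_upper[of c d] d by (auto simp: c_def elim: eventually_mono)
  qed simp
  moreover have "eventually (\<lambda>n. 4 < excess c d n \<and> excess c d n < real n - 2) at_top"
    by (rule eventually_excess_bounds) (use c d in auto)
  moreover have "eventually (\<lambda>n. n \<ge> 2 * K + 2) at_top" by (rule eventually_ge_at_top)
  ultimately show ?thesis
  proof eventually_elim
    case (elim n)
    define A where "A = excess c d n"
    \<comment> \<open>Rounding up gives A \<le> a < A + 2 for a = 2r - n, whence p \<le> A/2 + 1,
      the bound inside the logarithm of \<open>eventually_excess_upper\<close>.\<close>
    define r where "r = nat \<lceil>(real n + A) / 2\<rceil>"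
    have A: "4 < A" "A < real n - 2" using elim by (auto simp: A_def)
    have r: "(real n + A) / 2 \<le> real r" "real r < (real n + A) / 2 + 1"
      using A by (auto simp: r_def) linarith+
    define a where "a = 2 * r - n"
    have "real n < real (2 * r)" using r A by simp
    then have "n < 2 * r" by (simp only: of_nat_less_iff)
    then have ra: "2 * r = n + a" by (simp add: a_def)
    then have "2 * real r = real n + real a" by linarith
    then have a: "A \<le> real a" "real a < A + 2" using r by (auto simp: field_simps)
    define p where "p = 2 * (a div 4)"
    have p: "real p \<le> real a / 2" unfolding p_def by linarith
    have "real r < real n" using r A by (simp add: field_simps)
    then have rn: "r < n" by (simp only: of_nat_less_iff)
    have n: "real n > 0" using A by simp
    have mono: "(A\<^sup>2 / 2 - 8) / real n \<le> ((real a)\<^sup>2 / 2 - 8) / real n"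
      using a A n by (intro divide_right_mono diff_right_mono power_mono) auto
    have "real (2 * K * (K + p)) ^ K < exp (((real a)\<^sup>2 / 2 - 8) / real n)"
    \<comment> \<open>For K = 0 the left-hand side is 1, so the exponent only has to be positive,
      which is A > 4.\<close>
    proof (cases "K = 0")
      case True
      have "4\<^sup>2 < A\<^sup>2" using A by (intro power_strict_mono) auto
      then have "(A\<^sup>2 / 2 - 8) / real n > 0" using n by simp
      then show ?thesis using True mono by simp
    next
      case False
      then have pos: "0 < real (2 * K * (K + p))" by simp
      then have "real (2 * K * (K + p)) ^ K = exp (real K * ln (real (2 * K * (K + p))))"
        by (simp only: exp_of_nat_mult exp_ln)
      also have "\<dots> < exp (((real a)\<^sup>2 / 2 - 8) / real n)"
      proof (subst exp_less_cancel_iff)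
        have "real (K + p) \<le> real K + A / 2 + 1" using p a by simp
        then have "2 * real K * real (K + p) \<le> 2 * real K * (real K + A / 2 + 1)"
          by (intro mult_left_mono) auto
        then have "real (2 * K * (K + p)) \<le> 2 * real K * (real K + A / 2 + 1)" by simp
        then have "real K * ln (real (2 * K * (K + p))) \<le> real K * ln (2 * real K * (real K + A / 2
            + 1))"
          using pos by (intro mult_left_mono ln_mono) auto
        also have "\<dots> < (A\<^sup>2 / 2 - 8) / real n" using elim False c by (simp add: A_def)
        finally show "real K * ln (real (2 * K * (K + p))) < ((real a)\<^sup>2 / 2 - 8) / real n" using mono
            by simp
      qed
      finally show ?thesis .
    qed
    then have "diff_coeff n (Suc K) r (int (p - 1)) < 0"
      using ra rn a A elim p_def by (intro diff_coeff_negI) auto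
    then have "Hdepth1 TYPE('a) n (Suc K) < r"
      using elim by (intro Hdepth1_less) auto
    then have "real (Hdepth1 TYPE('a) n (Suc K)) + 1 \<le> real r" by linarith
    then show ?case using r by (simp add: A_def c_def field_simps)
  qed
qed

lemma eventually_Hdepth1_greater:
  fixes d :: real
  assumes K: "K > 0" and d: "0 < d" "d < sqrt (real K) / 2"
  shows "eventually (\<lambda>n. (real n + excess (sqrt (real K)) d n) / 2 - 1 < real (Hdepth1
      TYPE('a::field) n (Suc K))) at_top"
proof -
  define c where "c = sqrt (real K)"
  have c: "c > 0" "c\<^sup>2 = real K" using K by (auto simp: c_def)
  have "eventually (\<lambda>n. (excess c d n + 1)\<^sup>2 < 2 * (real n - excess c d n) * (c\<^sup>2 * ln (1
      + (excess c d n - 2) / (4 * c\<^sup>2)))) at_top"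
    by (rule eventually_excess_lower) (use c d in \<open>auto simp: c_def\<close>)
  moreover have "eventually (\<lambda>n. 4 < excess c d n \<and> excess c d n < real n - 2) at_top"
    by (rule eventually_excess_bounds) (use c d in auto)
  moreover have "eventually (\<lambda>n. n \<ge> K + 2) at_top" by (rule eventually_ge_at_top)
  ultimately show ?thesis
  proof eventually_elim
    case (elim n)
    define A where "A = excess c d n"
    \<comment> \<open>Rounding down gives A - 2 < a \<le> A for a = r - s: the lower bound serves
      the logarithm, the upper one the square.\<close>
    define r where "r = nat \<lfloor>(real n + A) / 2\<rfloor>"
    have A: "4 < A" "A < real n - 2" using elim by (auto simp: A_def)
    have r: "real r \<le> (real n + A) / 2" "(real n + A) / 2 - 1 < real r"
    proof -
      have "real r = of_int \<lfloor>(real n + A) / 2\<rfloor>" using A by (simp add: r_def)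
      then show "real r \<le> (real n + A) / 2" "(real n + A) / 2 - 1 < real r" by linarith+
    qed
    have "real r < real n" using r A by (simp add: field_simps)
    then have rn: "r < n" by (simp only: of_nat_less_iff)
    define s where "s = n - r"
    have s: "s > 0" "real s = real n - real r" using rn by (auto simp: s_def)
    define a where "a = real r - real s"
    have a: "A - 2 < a" "a \<le> A" using r s by (auto simp: a_def field_simps)
    have "(a + 1)\<^sup>2 \<le> (A + 1)\<^sup>2" using a A by (intro power_mono) auto
    also have "\<dots> \<le> (2 * (real n - A)) * (real K * ln (1 + (A - 2) / (4 * real K)))"
      using elim c by (simp add: A_def)
    also have "\<dots> \<le> (4 * real s) * (real K * ln (1 + a / (4 * real K)))"
    proof (rule mult_mono)
      show "2 * (real n - A) \<le> 4 * real s" using s(2) r(1) by (simp add: field_simps)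
      show "real K * ln (1 + (A - 2) / (4 * real K)) \<le> real K * ln (1 + a / (4 * real K))"
        using a A K by (intro mult_left_mono ln_mono add_left_mono divide_right_mono) (auto intro!:
            add_pos_nonneg)
    qed (use A K in auto)
    finally have "(a + 1)\<^sup>2 / (4 * real s) \<le> real K * ln (1 + a / (4 * real K))"
      using s by (simp add: divide_le_eq mult.commute)
    then have "r choose p \<le> ((K + p) choose K) * ((s + p - 1) choose p)" for p
      using choose_le_mult_rising[OF s(1) K, of r p] a A by (simp add: a_def)
    then have "diff_coeff n (Suc K) r (int q) \<ge> 0" for q
      using rn by (intro diff_coeff_nonnegI) (auto simp: s_def)
    then have "r \<le> Hdepth1 TYPE('a) n (Suc K)"
      using rn elim by (intro Hdepth1_ge) auto
    then have "real r \<le> real (Hdepth1 TYPE('a) n (Suc K))" by simp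
    then show ?case using r by (simp add: A_def c_def field_simps)
  qed
qed

text \<open>For k = 1 the polynomial factor is 1, and r \<le> n - r makes the comparison of
  binomials plain monotonicity in the upper index.\<close>

lemma Hdepth1_ge_half:
  assumes "n > 0"
  shows "n div 2 \<le> Hdepth1 TYPE('a::field) n 1"
proof -
  have "n div 2 choose p \<le> (n - n div 2 + p - 1) choose p" for p
    using assms by (cases "p = 0") (auto intro!: binomial_right_mono)
  then have "diff_coeff n 1 (n div 2) (int q) \<ge> 0" for q
    by (intro diff_coeff_nonnegI) auto
  then show ?thesis using assms by (intro Hdepth1_ge) auto
qed

text \<open>Perturbing d = c/2 by \<epsilon> moves the depth by (\<epsilon>/2) g(n), where g is the
  function in the error term. As g tends to infinity, another (\<epsilon>/2) g(n) absorbs the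
  rounding error 1.\<close>

theorem theorem4p1:
  fixes k :: nat
  assumes "k > 0"
  shows "(\<lambda>n::nat. real (Hdepth1 TYPE('a::field) n k)
            - (real n / 2 + sqrt ((real k - 1) * real n * ln (real n)) / 2
               + sqrt ((real k - 1) * real n / ln (real n)) * ln (ln (real n)) / 4))
         \<in> o(\<lambda>n::nat. sqrt (real n / ln (real n)) * ln (ln (real n)))"
proof (rule landau_o.smallI)
  fix \<epsilon> :: real assume \<epsilon>: "\<epsilon> > 0"
  obtain K where k: "k = Suc K" using assms by (cases k) auto
  define c where "c = sqrt (real K)"
  define g where "g n = sqrt (real n / ln (real n)) * ln (ln (real n))" for n :: nat
  define H where "H n = real (Hdepth1 TYPE('a) n k)" for n
  have c: "c \<ge> 0" by (simp add: c_def)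
  have ex: "excess c d n = c * sqrt (real n * ln (real n)) + d * g n" for d n
    by (simp add: excess_def g_def)
  have goal_eq: "real n / 2 + sqrt ((real k - 1) * real n * ln (real n)) / 2
               + sqrt ((real k - 1) * real n / ln (real n)) * ln (ln (real n)) / 4 = (real n +
                   excess c (c /
                   2) n) / 2" for n
    by (simp add: excess_def k c_def real_sqrt_mult real_sqrt_divide algebra_simps add_divide_distrib)
  have g: "eventually (\<lambda>n. g n > 0 \<and> 1 \<le> \<epsilon> / 2 * g n) at_top"
    unfolding g_def eventually_conj_iff using \<epsilon> by (intro conjI) real_asymp+
  have upper: "eventually (\<lambda>n. H n < (real n + excess c (c / 2 + \<epsilon>) n) / 2) at_top"
    unfolding H_def k c_def by (rule eventually_Hdepth1_less) (use \<epsilon> c in \<open>auto simp: c_def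
        intro: add_nonneg_pos\<close>)
  have lower: "eventually (\<lambda>n. (real n + excess c (c / 2 - \<epsilon>) n) / 2 - 1 \<le> H n) at_top"
  \<comment> \<open>For K = 0 the perturbed coefficient is negative, so the bound n div 2 already
    lies above the required value up to rounding.\<close>
  proof (cases "K = 0")
    case True
    have "eventually (\<lambda>n::nat. n > 0) at_top" by (rule eventually_gt_at_top)
    with g show ?thesis
    proof eventually_elim
      case (elim n)
      have "real (n div 2) \<le> H n"
        using Hdepth1_ge_half[of n, where 'a = 'a] elim k True by (simp add: H_def)
      moreover have "real n / 2 - 1 \<le> real (n div 2)" by linarith
      moreover have "excess c (c / 2 - \<epsilon>) n \<le> 0" unfolding ex using elim \<epsilon> True by
          (simp add: c_def)
      ultimately show ?case by (simp add: add_divide_distrib)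
    qed
  next
    case False
    then have c0: "c > 0" by (simp add: c_def)
    \<comment> \<open>The maximum with c/4 keeps d positive when \<epsilon> is large; raising d only
      strengthens the lower bound.\<close>
    define d where "d = max (c / 2 - \<epsilon>) (c / 4)"
    have d: "0 < d" "d < c / 2" "c / 2 - \<epsilon> \<le> d" using c0 \<epsilon> by (auto simp: d_def max_def)
    have "eventually (\<lambda>n. (real n + excess c d n) / 2 - 1 < H n) at_top"
      unfolding H_def k c_def by (rule eventually_Hdepth1_greater) (use d False in \<open>auto simp: c_def\<close>)
    with g show ?thesis
    proof eventually_elim
      case (elim n)
      have "excess c (c / 2 - \<epsilon>) n \<le> excess c d n"
        unfolding ex using elim d by (intro add_left_mono mult_right_mono) auto
      then show ?case using elim by (simp add: field_simps)
    qed
  qed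
  from g upper lower have "eventually (\<lambda>n. norm (H n - (real n + excess c (c / 2) n) / 2) \<le>
      \<epsilon> * norm (g n)) at_top"
  proof eventually_elim
    case (elim n)
    then have "H n < (real n + excess c (c / 2) n) / 2 + \<epsilon> / 2 * g n"
      "(real n + excess c (c / 2) n) / 2 - \<epsilon> / 2 * g n - 1 \<le> H n"
      by (auto simp: ex field_simps)
    then show ?case using elim by (simp add: abs_le_iff)
  qed
  then show "eventually (\<lambda>n. norm (real (Hdepth1 TYPE('a::field) n k)
            - (real n / 2 + sqrt ((real k - 1) * real n * ln (real n)) / 2
               + sqrt ((real k - 1) * real n / ln (real n)) * ln (ln (real n)) / 4))
         \<le> \<epsilon> * norm (sqrt (real n / ln (real n)) * ln (ln (real n)))) at_top"
    unfolding goal_eq by (simp only: H_def g_def)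
qed

end
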